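(* Let $p>1$ and let $f\in C^1([0,\infty))$. Assume that for some $\gamma>0$ $$f(u)<0\ \text{ for } u\in(0,\gamma),\qquad f(u)>0\ \text{ for } u>\gamma,$$ that $$f'(u)-(p-1)\frac{f(u)}{u}>0\qquad\text{for } u>\gamma,$$ and that $\lim_{u\to\infty}\frac{f(u)}{u^q}$ exists and is positive for some $q>p-1$. In case $f(0)=0$, assume additionally that for some $c_0>0$, $-f(s)<c_0 s^{p-1}$ for all small $s>0$. Consider, for $\lambda>0$, the problem $$\varphi(u'(x))'+\lambda f(u(x))=0\quad\text{for } -1<x<1,\qquad u(-1)=u(1)=0. \tag{P$_\lambda$}$$ Then (P$_\lambda$) has at most one positive solution for any $\lambda>0$, while for $\lambda$ sufficiently small (P$_\lambda$) has a unique positive solution. Moreover, all positive solutions of (P$_\lambda$) are non-degenerate, and they lie on a unique solution curve, extending for $0<\lambda\le\lambda_0\le\infty$. Denote by $u(x,\lambda)$ the positive solution at $\lambda$. (a) In case $f(0)<0$: we have $\lambda_0<\infty$, there are no turns on the solution curve, $u(0,\lambda)\to\infty$ as $\lambda\to0$, and $u'(\pm1,\lambda_0)=0$ (prime denotes the derivative in $x$). That is, for $\lambda>\lambda_0$ there are no positive solutions, while for $0<\lambda\le\lambda_0$ there is a unique positive non-degenerate solution. (b) In case $f(0)=0$: we have $\lambda_0=\infty$, there are no turns on the solution curve, $u(0,\lambda)\to\infty$ as $\lambda\to0$, and $\lim_{\lambda\to\infty}u(x,\lambda)=0$ for $x\ne0$. That is, for all $\lambda>0$ there is a unique positive non-degenerate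 solution.
   Context: Here $\varphi(t)=t|t|^{p-2}$ (with $\varphi(0)=0$) and $\varphi'(t)=(p-1)|t|^{p-2}$. Solutions $u$ are classical: $u\in C^1[-1,1]$ with $\varphi(u')$ continuously differentiable; positive means $u(x)>0$ on $(-1,1)$. A solution $u$ of (P$_\lambda$) is called non-degenerate if the linearized problem $$\bigl(\varphi'(u'(x))w'(x)\bigr)'+\lambda f'(u(x))w(x)=0\ \text{ for } -1<x<1,\qquad w(-1)=w(1)=0,$$ has only the trivial solution $w\equiv0$; otherwise it is degenerate. Here $w\in C^1[-1,1]$, with $\varphi'(u')w'$ (extended by continuity where $u'=0$) continuously differentiable on $(-1,1)$. A solution curve is a continuous curve of pairs $(\lambda,u)$, with $u$ a positive solution of (P$_\lambda$); it has no turns if it can be parametrized by $\lambda$, i.e. it contains exactly one pair for each $\lambda$ in its range. When $\lambda_0=\infty$, the range $0<\lambda\le\lambda_0$ means $0<\lambda<\infty$.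
   Formalization: Non-degeneracy is not claimed when 1<p≤2 and u'(±1)=0 (i.e. at λ=λ_0 in case (a)): there w=u' is a nontrivial solution of the linearized problem, e.g. p=2, f(u)=u^3-1. All other claims, including non-degeneracy at λ_0 for p>2, are kept. *)

theory Defs
  imports "HOL-Analysis.Analysis"
begin

definition phi :: "real \<Rightarrow> real \<Rightarrow> real" where
  "phi p t = t * \<bar>t\<bar> powr (p - 2)"

text \<open>Since \<open>0 powr a = 0\<close> for every \<open>a\<close>, this has the intended value only for \<open>t \<noteq> 0\<close>
  when \<open>p \<le> 2\<close>; it is only used at arguments \<open>t \<noteq> 0\<close>.\<close>

definition dphi :: "real \<Rightarrow> real \<Rightarrow> real" where
  "dphi p t = (p - 1) * \<bar>t\<bar> powr (p - 2)"

text \<open>Derivative on \<open>[-1,1]\<close>, one-sided at the endpoints.\<close>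

definition D1 :: "(real \<Rightarrow> real) \<Rightarrow> real \<Rightarrow> real" where
  "D1 u x = vector_derivative u (at x within {-1..1})"

definition C1_closed :: "(real \<Rightarrow> real) \<Rightarrow> bool" where
  "C1_closed u \<longleftrightarrow>
     (\<forall>x\<in>{-1..1}. u differentiable (at x within {-1..1})) \<and> continuous_on {-1..1} (D1 u)"

text \<open>A function on \<open>[-1,1]\<close> is represented by its extensional representative, so that
  equality of solutions is equality of functions on \<open>[-1,1]\<close>.\<close>

definition is_solution :: "real \<Rightarrow> (real \<Rightarrow> real) \<Rightarrow> real \<Rightarrow> (real \<Rightarrow> real) \<Rightarrow> bool" where
  "is_solution p f l u \<longleftrightarrow>
     u \<in> extensional {-1..1} \<and> C1_closed u \<and> C1_closed (\<lambda>x. phi p (D1 u x)) \<and>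
     (\<forall>x\<in>{-1<..<1}. D1 (\<lambda>y. phi p (D1 u y)) x + l * f (u x) = 0) \<and>
     u (-1) = 0 \<and> u 1 = 0"

definition positive_solution :: "real \<Rightarrow> (real \<Rightarrow> real) \<Rightarrow> real \<Rightarrow> (real \<Rightarrow> real) \<Rightarrow> bool" where
  "positive_solution p f l u \<longleftrightarrow> is_solution p f l u \<and> (\<forall>x\<in>{-1<..<1}. u x > 0)"

text \<open>\<open>g\<close> is the extension by continuity of \<open>\<phi>'(u') w'\<close> across the zeros of \<open>u'\<close>;
  \<open>f'\<close> is the derivative of \<open>f\<close>.\<close>

definition linearized_solution ::
  "real \<Rightarrow> (real \<Rightarrow> real) \<Rightarrow> real \<Rightarrow> (real \<Rightarrow> real) \<Rightarrow> (real \<Rightarrow> real) \<Rightarrow> bool" where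
  "linearized_solution p f' l u w \<longleftrightarrow>
     C1_closed w \<and> w (-1) = 0 \<and> w 1 = 0 \<and>
     (\<exists>g. g C1_differentiable_on {-1<..<1} \<and>
          (\<forall>x\<in>{-1<..<1}. D1 u x \<noteq> 0 \<longrightarrow> g x = dphi p (D1 u x) * D1 w x) \<and>
          (\<forall>x\<in>{-1<..<1}. deriv g x + l * f' (u x) * w x = 0))"

definition nondegenerate ::
  "real \<Rightarrow> (real \<Rightarrow> real) \<Rightarrow> real \<Rightarrow> (real \<Rightarrow> real) \<Rightarrow> bool" where
  "nondegenerate p f' l u \<longleftrightarrow>
     (\<forall>w. linearized_solution p f' l u w \<longrightarrow> (\<forall>x\<in>{-1..1}. w x = 0))"

text \<open>Pitfall: if \<open>1 < p \<le> 2\<close> and \<open>u'(-1) = u'(1) = 0\<close>, then \<open>w = u'\<close> is itself a nontrivial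
  solution of the linearized problem, because differentiating the equation for \<open>u\<close> gives
  \<open>(\<phi>'(u') u'')' + \<lambda> f'(u) u' = 0\<close>; such a \<open>u\<close> is degenerate. For \<open>p > 2\<close> this does not occur,
  as \<open>u'\<close> is not \<open>C\<^sup>1\<close> at \<open>0\<close>.\<close>

text \<open>Continuity of a family of functions in the norm of \<open>C\<^sup>1[-1,1]\<close>.\<close>

definition continuous_in_C1 :: "real set \<Rightarrow> (real \<Rightarrow> real \<Rightarrow> real) \<Rightarrow> bool" where
  "continuous_in_C1 I U \<longleftrightarrow>
     (\<forall>s\<in>I. uniform_limit {-1..1} U (U s) (at s within I) \<and>
            uniform_limit {-1..1} (\<lambda>t. D1 (U t)) (D1 (U s)) (at s within I))"

definition solution_curve ::
  "real \<Rightarrow> (real \<Rightarrow> real) \<Rightarrow> (real \<times> (real \<Rightarrow> real)) set \<Rightarrow> bool" where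
  "solution_curve p f C \<longleftrightarrow>
     (\<exists>I l U. is_interval I \<and> I \<noteq> {} \<and> continuous_on I l \<and> continuous_in_C1 I U \<and>
        (\<forall>s\<in>I. l s > 0 \<and> positive_solution p f (l s) (U s)) \<and>
        C = (\<lambda>s. (l s, U s)) ` I)"

definition no_turns :: "(real \<times> (real \<Rightarrow> real)) set \<Rightarrow> bool" where
  "no_turns C \<longleftrightarrow>
     (\<exists>U. continuous_in_C1 (fst ` C) U \<and> C = (\<lambda>l. (l, U l)) ` (fst ` C))"

end

theory Submission
  imports Defs
begin

text \<open>
  The problem is autonomous, so the energy
  \<open>(p - 1)/p \<bar>u'\<bar>\<^sup>p + \<lambda> F(u)\<close>, with \<open>F\<close> the primitive of \<open>f\<close>, is constant along a solution. If \<open>a\<close> is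
  the maximum of a positive solution, then \<open>\<bar>u'\<bar>\<^sup>p = (p/(p - 1)) \<lambda> (F a - F u)\<close>; hence \<open>u\<close> increases
  from \<open>0\<close> to \<open>a\<close> and decreases back to \<open>0\<close> in equal times, its maximum sits at \<open>x = 0\<close>, and
  separating variables gives \<open>\<lambda> = (p - 1)/p T(a)\<^sup>p\<close> with the time map
  \<open>T(a) = \<integral>\<^sub>0\<^sup>a (F a - F u) powr (-1/p) du\<close>. Conversely every height \<open>a\<close> with \<open>F a \<ge> 0\<close> and
  \<open>T(a) < \<infinity>\<close> yields a solution by inverting this integral. The theorem is therefore a statement about
  the one function \<open>T\<close>.

  Substituting \<open>u = a s\<close> turns \<open>T\<close> into the integral over \<open>(0, 1)\<close> of
  \<open>((F a - F(a s)) / a\<^sup>p) powr (-1/p)\<close>. The derivative of the bracket in \<open>a\<close> is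
  \<open>(H(a) - H(a s)) / a powr (p + 1)\<close> with \<open>H(u) = u f(u) - p F(u)\<close>. Above \<open>\<gamma>\<close> the superlinearity
  condition says exactly that \<open>H\<close> increases, and below \<open>\<gamma>\<close> the sign of \<open>f\<close> gives
  \<open>H(u) \<le> -p F(\<gamma>) = H(\<gamma>)\<close>. So \<open>H(a s) < H(a)\<close> (\<open>H_less\<close>), the integrand decreases in \<open>a\<close> for every
  \<open>s\<close>, and \<open>T\<close> is strictly decreasing (\<open>time_map_strict_antimono\<close>). This gives uniqueness and the absence of
  turns without any bifurcation argument. The same monotonicity supplies the dominating function from
  which continuity of \<open>T\<close> and \<open>T(a) \<rightarrow> 0\<close> as \<open>a \<rightarrow> \<infinity>\<close> follow.

  The two cases differ at the smallest height \<open>\<theta>\<close>, where \<open>F \<theta> = 0\<close>. If \<open>f(0) < 0\<close>, the integrand is like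
  \<open>u powr (-1/p)\<close> near \<open>u = 0\<close>, \<open>T(\<theta>)\<close> is finite, and the curve ends at \<open>\<lambda>\<^sub>0 = (p - 1)/p T(\<theta>)\<^sup>p\<close> with
  \<open>u'(\<plusminus>1) = 0\<close>. If \<open>f(0) = 0\<close>, the bound on \<open>-f\<close> gives \<open>-F(u) \<le> c u\<^sup>p\<close>, the integrand is at least of
  order \<open>1/u\<close>, and \<open>T(a) \<rightarrow> \<infinity>\<close> as \<open>a\<close> decreases to \<open>\<theta>\<close> (\<open>time_map_large\<close>); since the part of the integral away
  from \<open>u = 0\<close> stays bounded, the solution spends most of its time near \<open>0\<close>, whence the
  concentration at \<open>x = 0\<close> (\<open>rel_height_small_near_theta\<close>).

  For non-degeneracy let \<open>w\<close> solve the linearized problem and let \<open>g\<close> be its flux \<open>\<phi>'(u') w'\<close>. The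
  translation \<open>u'\<close> solves the linearized equation too, and the Wronskian of the two is the constant
  \<open>\<lambda> f(a) w(0)\<close>. If \<open>w(0) > 0\<close>, this constant is not \<open>0\<close>, which excludes \<open>u'(\<plusminus>1) = 0\<close>, and one computes on \<open>(0, 1)\<close> that \<open>(w - (w(0)/a) u)/\<bar>u'\<bar>\<close> is
  decreasing, again because \<open>H(u) < H(a)\<close>; as it vanishes at \<open>1\<close> it is positive, and this forces
  \<open>g(0) > 0\<close> (\<open>half_linearized_flux_pos\<close>). Reflecting \<open>x\<close> changes the sign of \<open>g\<close>, so the left half
  forces \<open>g(0) < 0\<close>. Hence \<open>w(0) = 0\<close>, the Wronskian vanishes, \<open>w\<close> is a multiple of \<open>u'\<close> on each
  half, and the multiple is \<open>0\<close> by \<open>w(\<plusminus>1) = 0\<close> if \<open>u'(\<plusminus>1) \<noteq> 0\<close>, and by \<open>g(0) = 0\<close> if \<open>p > 2\<close>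
  (\<open>half_linearized_zero\<close>).
\<close>

section \<open>One-variable calculus\<close>

text \<open>A continuous formula for \<open>u'\<close> that is valid off a finite set is valid everywhere, one-sidedly at the
  endpoints: \<open>u\<close> is the integral of the formula. This spares any direct difference quotients at
  \<open>x = 0\<close>, where \<open>u' = 0\<close> and \<open>\<phi>\<close> may be singular, and at \<open>x = \<plusminus>1\<close>.\<close>

lemma C1_up_to_endpoints:
  fixes u h :: "real \<Rightarrow> real"
  assumes S: "finite S" and u: "continuous_on {a..b} u" and h: "continuous_on {a..b} h"
    and der: "\<And>x. x \<in> {a<..<b} - S \<Longrightarrow> (u has_real_derivative h x) (at x)"
    and x: "x \<in> {a..b}"
  shows "(u has_vector_derivative h x) (at x within {a..b})"
proof -
  have eq: "u a + integral {a..y} h = u y" if "y \<in> {a..b}" for y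
  proof -
    have "(h has_integral (u y - u a)) {a..y}"
      using that continuous_on_subset[OF u]
      by (intro fundamental_theorem_of_calculus_interior_strong[OF S])
         (auto intro!: der[unfolded has_real_derivative_iff_has_vector_derivative])
    then show ?thesis
      by (simp add: integral_unique)
  qed
  have "((\<lambda>y. u a + integral {a..y} h) has_vector_derivative h x) (at x within {a..b})"
    using integral_has_vector_derivative[OF h x] has_vector_derivative_add[OF has_vector_derivative_const]
    by fastforce
  then show ?thesis
    using has_vector_derivative_transform[OF x, of u "\<lambda>y. u a + integral {a..y} h"] eq by simp
qed

lemma D1_eqI:
  assumes "(u has_vector_derivative h) (at x within {-1..1})" "x \<in> {-1..1::real}"
  shows "D1 u x = h"
proof -
  have "at x within {-1..1::real} \<noteq> bot"
    using assms(2) by (auto simp: trivial_limit_within islimpt_Icc)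
  then show ?thesis
    unfolding D1_def using vector_derivative_within assms(1) by blast
qed

lemma C1_closedI:
  assumes "continuous_on {-1..1} h"
    and "\<And>x. x \<in> {-1..1} \<Longrightarrow> (u has_vector_derivative h x) (at x within {-1..1})"
  shows "C1_closed u"
proof -
  have "continuous_on {-1..1} (D1 u) \<longleftrightarrow> continuous_on {-1..1} h"
    by (rule continuous_on_cong) (auto intro!: D1_eqI assms(2))
  then show ?thesis
    unfolding C1_closed_def using assms by (force intro: differentiableI_vector)
qed

lemma C1_closed_derivative:
  assumes "C1_closed u" "x \<in> {-1..1}"
  shows "(u has_vector_derivative D1 u x) (at x within {-1..1})"
  using assms unfolding C1_closed_def D1_def by (simp add: vector_derivative_works)

lemma C1_closed_DERIV:
  assumes "C1_closed u" "x \<in> {-1<..<1}"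
  shows "(u has_real_derivative D1 u x) (at x)"
proof -
  have "at x within {-1..1} = at x"
    using assms(2) by (intro at_within_interior) auto
  then show ?thesis
    using C1_closed_derivative[OF assms(1), of x] assms(2)
    by (simp add: has_real_derivative_iff_has_vector_derivative)
qed

lemma C1_closed_continuous: "C1_closed u \<Longrightarrow> continuous_on {-1..1} u"
  unfolding C1_closed_def by (meson continuous_on_eq_continuous_within differentiable_imp_continuous_within)

lemma DERIV_constant_on_Icc:
  fixes f :: "real \<Rightarrow> real"
  assumes "continuous_on {a..b} f" "finite S"
    and "\<And>x. x \<in> {a<..<b} - S \<Longrightarrow> (f has_real_derivative 0) (at x)"
    and "x \<in> {a..b}" "y \<in> {a..b}"
  shows "f x = f y"
proof -
  have "f z = f a" if "z \<in> {a..b}" for z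
  proof (rule has_derivative_zero_unique_strong_interval[OF _ assms(1) refl _ that])
    show "finite (insert a (insert b S))" using assms(2) by simp
    fix x assume "x \<in> {a..b} - insert a (insert b S)"
    then have "(f has_real_derivative 0) (at x within {a..b})"
      by (intro DERIV_subset[OF assms(3)]) auto
    then show "(f has_derivative (\<lambda>h. 0)) (at x within {a..b})"
      by (simp add: has_field_derivative_def lambda_zero)
  qed
  then show ?thesis using assms(4,5) by metis
qed

text \<open>With \<open>m = p/(p - 1)\<close> this differentiates the kinetic energy \<open>\<bar>u'\<bar>\<^sup>p = \<bar>\<phi>(u')\<bar>\<^sup>m\<close> through the flux
  \<open>\<phi>(u')\<close>, which is \<open>C\<^sup>1\<close>, including where the flux vanishes.\<close>

lemma DERIV_abs_powr:
  fixes y m :: real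
  assumes m: "m > 1"
  shows "((\<lambda>y. \<bar>y\<bar> powr m) has_real_derivative m * (sgn y * \<bar>y\<bar> powr (m - 1))) (at y)"
proof -
  consider "y > 0" | "y < 0" | "y = 0" by linarith
  then show ?thesis
  proof cases
    case 1
    have "((\<lambda>y. y powr m) has_real_derivative m * (sgn y * \<bar>y\<bar> powr (m - 1))) (at y)"
      using 1 by (auto intro!: derivative_eq_intros simp: powr_diff)
    moreover have "eventually (\<lambda>y. 0 < y) (nhds y)"
      using 1 by (intro eventually_nhds_in_open[of "{0<..}", simplified]) auto
    then have "eventually (\<lambda>y. y powr m = \<bar>y\<bar> powr m) (nhds y)"
      by eventually_elim auto
    ultimately show ?thesis
      by (simp add: DERIV_cong_ev)
  next
    case 2
    have "((\<lambda>y. (-y) powr m) has_real_derivative m * (sgn y * \<bar>y\<bar> powr (m - 1))) (at y)"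
      using 2 by (auto intro!: derivative_eq_intros simp: powr_diff field_simps)
    moreover have "eventually (\<lambda>y. y < 0) (nhds y)"
      using 2 by (intro eventually_nhds_in_open[of "{..<0}", simplified]) auto
    then have "eventually (\<lambda>y. (-y) powr m = \<bar>y\<bar> powr m) (nhds y)"
      by eventually_elim auto
    ultimately show ?thesis
      by (simp add: DERIV_cong_ev)
  next
    case 3
    have "((\<lambda>h. \<bar>h\<bar> powr (m - 1)) \<longlongrightarrow> 0) (at (0::real))"
      using m by (intro tendsto_eq_intros refl | auto)+
    then have "((\<lambda>h. sgn h * \<bar>h\<bar> powr (m - 1)) \<longlongrightarrow> 0) (at (0::real))"
      by (rule tendsto_rabs_zero_cancel[OF tendsto_sandwich[OF _ _ tendsto_const], rotated 2])
         (auto intro!: always_eventually simp: abs_mult sgn_if)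
    moreover have "sgn h * \<bar>h\<bar> powr (m - 1) = \<bar>h\<bar> powr m / h" for h :: real
      by (auto simp: sgn_if powr_diff field_simps)
    ultimately show ?thesis
      using 3 by (simp add: DERIV_def)
  qed
qed

lemma phi_eq: "phi p t = sgn t * \<bar>t\<bar> powr (p - 1)"
  unfolding phi_def by (auto simp: sgn_if powr_diff field_simps powr_numeral power2_eq_square)

lemma phi_0 [simp]: "phi p 0 = 0"
  by (simp add: phi_def)

lemma phi_inverse:
  assumes "p > 1"
  shows "sgn (phi p t) * \<bar>phi p t\<bar> powr (1 / (p - 1)) = t"
  using assms by (cases "t = 0") (simp_all add: phi_eq abs_mult powr_powr sgn_mult sgn_mult_abs)

lemma abs_phi_powr:
  assumes "p > 1"
  shows "\<bar>phi p t\<bar> powr (p / (p - 1)) = \<bar>t\<bar> powr p"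
  using assms by (cases "t = 0") (simp_all add: phi_eq abs_mult powr_powr)

lemma continuous_on_phi:
  assumes p: "p > 1" and v: "continuous_on S v"
  shows "continuous_on S (\<lambda>x. phi p (v x))"
proof -
  have "isCont (phi p) t" for t
  proof (cases "t = 0")
    case False
    then show ?thesis
      unfolding phi_def by (intro continuous_intros) auto
  next
    case True
    have "((\<lambda>h. \<bar>h\<bar> powr (p - 1)) \<longlongrightarrow> 0) (at (0::real))"
      using p by (intro tendsto_eq_intros refl | auto)+
    then have "(phi p \<longlongrightarrow> 0) (at 0)"
      by (rule tendsto_rabs_zero_cancel[OF tendsto_sandwich[OF _ _ tendsto_const], rotated 2])
         (auto intro!: always_eventually simp: phi_eq abs_mult sgn_if)
    then show ?thesis
      using True by (simp add: isCont_def)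
  qed
  then show ?thesis
    using continuous_on_compose2[OF _ v, of UNIV "phi p"] by (simp add: continuous_at_imp_continuous_on)
qed

lemma DERIV_abs:
  fixes x :: real
  assumes "x \<noteq> 0"
  shows "(abs has_real_derivative sgn x) (at x)"
proof -
  have "((\<lambda>y. sgn x * y) has_real_derivative sgn x) (at x)"
    by (auto intro!: derivative_eq_intros)
  then show ?thesis
    by (rule has_field_derivative_transform_within_open[of _ _ _ "if x > 0 then {0<..} else {..<0}"])
       (use assms in \<open>auto simp: sgn_if\<close>)
qed

text \<open>For \<open>g(0) = 0\<close> the function \<open>sgn x g(x)\<close> equals \<open>g(max x 0) - g(min x 0)\<close>.\<close>

lemma continuous_on_sgn_mult:
  fixes g :: "real \<Rightarrow> real"
  assumes "continuous_on {-b..b} g" "g 0 = 0" "0 \<le> b"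
  shows "continuous_on {-b..b} (\<lambda>x. sgn x * g x)"
proof -
  have "continuous_on {-b..b} (\<lambda>x. g (max x 0) - g (min x 0))"
    using assms(3) by (intro continuous_intros continuous_on_compose2[OF assms(1)]) auto
  then show ?thesis
    by (rule continuous_on_eq) (auto simp: sgn_if max_def min_def assms(2))
qed

lemma continuous_on_two_arguments:
  assumes "continuous_on (A \<times> X) (\<lambda>(a, x). g a x)" "continuous_on S h" "continuous_on S k"
    and "\<And>s. s \<in> S \<Longrightarrow> h s \<in> A" "\<And>s. s \<in> S \<Longrightarrow> k s \<in> X"
  shows "continuous_on S (\<lambda>s. g (h s) (k s))"
proof -
  have "continuous_on S (\<lambda>s. (\<lambda>(a, x). g a x) (h s, k s))"
    by (rule continuous_on_compose2[OF assms(1)]) (use assms in \<open>auto intro: continuous_on_Pair\<close>)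
  then show ?thesis by simp
qed

lemma continuous_on_section:
  assumes "continuous_on (A \<times> X) (\<lambda>(a, x). g a x)" "a \<in> A"
  shows "continuous_on X (g a)"
  using continuous_on_two_arguments[OF assms(1) continuous_on_const continuous_on_id] assms(2) by simp

lemma tendsto_at_right_of_continuous_on:
  fixes h :: "real \<Rightarrow> real"
  assumes "continuous_on {b..c} h" "b < c"
  shows "(h \<longlongrightarrow> h b) (at_right b)"
proof -
  have "(h \<longlongrightarrow> h b) (at b within {b..c})"
    using assms unfolding continuous_on_def by auto
  then show ?thesis using assms(2) by (simp add: at_within_Icc_at_right)
qed

lemma tendsto_at_left_of_continuous_on:
  fixes h :: "real \<Rightarrow> real"
  assumes "continuous_on {b..c} h" "b < c"
  shows "(h \<longlongrightarrow> h c) (at_left c)"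
proof -
  have "(h \<longlongrightarrow> h c) (at c within {b..c})"
    using assms unfolding continuous_on_def by auto
  then show ?thesis using assms(2) by (simp add: at_within_Icc_at_left)
qed

lemma uniform_limit_of_joint_continuity:
  fixes h :: "real \<Rightarrow> real \<Rightarrow> real"
  assumes "continuous_on (I \<times> X) (\<lambda>(s, x). h s x)" "compact X" "s \<in> I"
  shows "uniform_limit X h (h s) (at s within I)"
  unfolding uniform_limit_iff
proof (intro allI impI)
  fix e :: real assume "e > 0"
  then obtain N where N: "s \<in> N" "open N"
    and close: "\<forall>t\<in>N \<inter> I. \<forall>x\<in>X. dist (h t x) (h s x) \<le> e / 2"
    using continuous_on_prod_compactE[OF assms, of "e / 2"] by auto
  have "\<forall>\<^sub>F t in at s within I. t \<in> N \<inter> I"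
    using N eventually_at_in_open[OF N(2,1)] by (auto simp: eventually_at_filter elim: eventually_mono)
  then show "\<forall>\<^sub>F t in at s within I. \<forall>x\<in>X. dist (h t x) (h s x) < e"
  proof (rule eventually_mono)
    fix t assume t: "t \<in> N \<inter> I"
    show "\<forall>x\<in>X. dist (h t x) (h s x) < e"
    proof
      fix x assume "x \<in> X"
      then have "dist (h t x) (h s x) \<le> e / 2" using close t by blast
      also have "\<dots> < e" using \<open>e > 0\<close> by simp
      finally show "dist (h t x) (h s x) < e" .
    qed
  qed
qed

section \<open>The potential and its scaling\<close>

locale p_laplace_nonlinearity =
  fixes p \<gamma> :: real and f f' :: "real \<Rightarrow> real"
  assumes p: "p > 1"
    and f_deriv: "\<And>u. u \<ge> 0 \<Longrightarrow> (f has_real_derivative f' u) (at u within {0..})"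
    and f'_cont: "continuous_on {0..} f'"
    and \<gamma>: "\<gamma> > 0"
    and f_neg: "\<And>u. 0 < u \<Longrightarrow> u < \<gamma> \<Longrightarrow> f u < 0"
    and f_pos: "\<And>u. \<gamma> < u \<Longrightarrow> f u > 0"
    and f_superlin: "\<And>u. \<gamma> < u \<Longrightarrow> f' u - (p - 1) * (f u / u) > 0"
    and f_growth: "\<exists>q>p - 1. \<exists>L>0. ((\<lambda>u. f u / u powr q) \<longlongrightarrow> L) at_top"
    and f_zero: "f 0 = 0 \<Longrightarrow> \<exists>c\<^sub>0>0. \<forall>\<^sub>F s in at_right 0. - f s < c\<^sub>0 * s powr (p - 1)"
begin

definition F :: "real \<Rightarrow> real" where
  "F x = integral {0..x} f"

text \<open>\<open>H\<close> governs how the scaled potential gap changes with \<open>a\<close> (\<open>gap_DERIV\<close>); its derivative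
  \<open>u f'(u) - (p - 1) f(u)\<close> has the sign of the superlinearity condition.\<close>

definition H :: "real \<Rightarrow> real" where
  "H u = u * f u - p * F u"

text \<open>The rescaling \<open>u = a s\<close> puts the trajectories of all heights on the same interval \<open>[0, 1]\<close>, so that
  they can be compared pointwise; dividing by \<open>a\<^sup>p\<close> absorbs the factor \<open>du/ds = a\<close> of the time
  integral.\<close>

definition gap :: "real \<Rightarrow> real \<Rightarrow> real" where
  "gap a s = (F a - F (a * s)) / a powr p"

text \<open>The heights of positive solutions. At \<open>x = \<plusminus>1\<close> the energy identity reads
  \<open>\<bar>u'\<bar>\<^sup>p = (p/(p - 1)) \<lambda> F a\<close>, so \<open>F a \<ge> 0\<close>. A solution with \<open>F a = 0\<close> meets the boundary with slope
  \<open>0\<close>; when also \<open>f(0) = 0\<close> it would need infinite time to get there.\<close>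

definition amplitudes :: "real set" where
  "amplitudes = {a. \<gamma> < a \<and> 0 \<le> F a \<and> (f 0 = 0 \<longrightarrow> 0 < F a)}"

lemma f_DERIV: "u > 0 \<Longrightarrow> (f has_real_derivative f' u) (at u)"
  using f_deriv[of u] at_within_interior[of u "{0..}"] by (simp add: interior_real_atLeast)

lemma f_continuous: "continuous_on {0..} f"
  by (rule DERIV_continuous_on[of _ _ f']) (auto intro: f_deriv)

lemma f_isCont: "u > 0 \<Longrightarrow> isCont f u"
  using f_DERIV DERIV_isCont by blast

lemma f_gamma: "f \<gamma> = 0"
proof (rule antisym)
  have lim: "(f \<longlongrightarrow> f \<gamma>) (at \<gamma>)"
    using f_isCont[OF \<gamma>] by (simp add: isCont_def)
  show "f \<gamma> \<le> 0"
  proof (rule tendsto_upperbound)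
    show "(f \<longlongrightarrow> f \<gamma>) (at_left \<gamma>)"
      using lim filterlim_at_split by blast
    show "\<forall>\<^sub>F u in at_left \<gamma>. f u \<le> 0"
      using eventually_at_left_real[OF \<gamma>] by eventually_elim (auto intro: less_imp_le f_neg)
  qed auto
  show "f \<gamma> \<ge> 0"
  proof (rule tendsto_lowerbound)
    show "(f \<longlongrightarrow> f \<gamma>) (at_right \<gamma>)"
      using lim filterlim_at_split by blast
    show "\<forall>\<^sub>F u in at_right \<gamma>. f u \<ge> 0"
      using eventually_at_right_less[of \<gamma>] by eventually_elim (auto intro: less_imp_le f_pos)
  qed auto
qed

lemma f_0_right: "(f \<longlongrightarrow> f 0) (at_right 0)"
proof -
  have "(f \<longlongrightarrow> f 0) (at 0 within {0..})"
    using f_continuous by (simp add: continuous_on)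
  then show ?thesis
    by (rule tendsto_within_subset) auto
qed

lemma f_0_nonpos: "f 0 \<le> 0"
proof (rule tendsto_upperbound[OF f_0_right])
  show "\<forall>\<^sub>F u in at_right 0. f u \<le> 0"
    using eventually_at_right_real[OF \<gamma>] by eventually_elim (auto intro: less_imp_le f_neg)
qed auto

lemma f_nonpos: "0 \<le> u \<Longrightarrow> u \<le> \<gamma> \<Longrightarrow> f u \<le> 0"
  using f_neg[of u] f_gamma f_0_nonpos by (cases "u = 0"; cases "u = \<gamma>") auto

lemma F_0 [simp]: "F 0 = 0"
  by (simp add: F_def)

lemma F_DERIV_within:
  assumes "0 \<le> x"
  shows "(F has_real_derivative f x) (at x within {0..})"
proof -
  have "((\<lambda>u. integral {0..u} f) has_vector_derivative f x) (at x within {0..x+1})"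
    using assms by (intro integral_has_vector_derivative continuous_on_subset[OF f_continuous]) auto
  moreover have "at x within {0..x+1} = at x within {0..}"
    by (rule at_within_nhd[of _ "{..<x+1}"]) auto
  moreover have "(\<lambda>u. integral {0..u} f) = F"
    by (auto simp: F_def)
  ultimately show ?thesis
    by (simp add: has_real_derivative_iff_has_vector_derivative)
qed

lemma F_DERIV: "x > 0 \<Longrightarrow> (F has_real_derivative f x) (at x)"
  using F_DERIV_within[of x] at_within_interior[of x "{0..}"] by (simp add: interior_real_atLeast)

lemma F_continuous: "continuous_on {0..} F"
  by (rule DERIV_continuous_on[of _ _ f]) (auto intro: F_DERIV_within)

lemma F_decreasing:
  assumes "0 \<le> u" "u < v" "v \<le> \<gamma>"
  shows "F v < F u"
  using assms
  by (intro DERIV_neg_imp_decreasing_open[of u v F])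
     (auto intro!: exI conjI F_DERIV f_neg continuous_on_subset[OF F_continuous])

lemma F_increasing:
  assumes "\<gamma> \<le> u" "u < v"
  shows "F u < F v"
  using assms \<gamma>
  by (intro DERIV_pos_imp_increasing_open[of u v F])
     (auto intro!: exI conjI F_DERIV f_pos continuous_on_subset[OF F_continuous])

lemma F_nonneg_imp_gt_gamma:
  assumes "0 < a" "0 \<le> F a"
  shows "\<gamma> < a"
  using F_decreasing[of 0 a] assms by fastforce

lemma F_less:
  assumes "\<gamma> < a" "0 \<le> F a" "0 < u" "u < a"
  shows "F u < F a"
  using F_decreasing[of 0 u] F_increasing[of u a] assms by fastforce

lemma H_DERIV: "u > 0 \<Longrightarrow> (H has_real_derivative (u * f' u - (p - 1) * f u)) (at u)"
  unfolding H_def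
  by (auto intro!: derivative_eq_intros f_DERIV F_DERIV simp: algebra_simps)

text \<open>Above \<open>\<gamma>\<close>, \<open>H\<close> is increasing by superlinearity; below \<open>\<gamma>\<close> its monotonicity is unknown, but \<open>u f(u) \<le> 0\<close> and \<open>F(u) \<ge> F(\<gamma>)\<close> bound it by
  \<open>H(\<gamma>)\<close>.\<close>

lemma H_less:
  assumes "\<gamma> < a" "0 \<le> u" "u < a"
  shows "H u < H a"
proof -
  have incr: "H v < H a" if "\<gamma> \<le> v" "v < a" for v
  proof (rule DERIV_pos_imp_increasing_open[OF that(2)])
    fix x assume x: "v < x" "x < a"
    have "0 < x * (f' x - (p - 1) * (f x / x))"
      using x that \<gamma> by (intro mult_pos_pos f_superlin) auto
    also have "x * (f' x - (p - 1) * (f x / x)) = x * f' x - (p - 1) * f x"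
      using x that \<gamma> by (simp add: right_diff_distrib)
    finally have "0 < x * f' x - (p - 1) * f x" .
    then show "\<exists>y. (H has_real_derivative y) (at x) \<and> 0 < y"
      using H_DERIV[of x] x that \<gamma> by force
  next
    show "continuous_on {v..a} H"
      using that \<gamma> by (intro DERIV_continuous_on[of _ _ "\<lambda>u. u * f' u - (p - 1) * f u"])
        (auto intro!: has_field_derivative_at_within H_DERIV)
  qed
  show ?thesis
  proof (cases "\<gamma> \<le> u")
    case True
    then show ?thesis using incr assms by blast
  next
    case False
    have "F \<gamma> \<le> F u"
      using F_decreasing[of u \<gamma>] False assms by auto
    moreover have "u * f u \<le> 0"
      using f_nonpos[of u] False assms by (simp add: mult_nonneg_nonpos)
    ultimately have "H u \<le> H \<gamma>"
      using p mult_left_mono[of "F \<gamma>" "F u" p] unfolding H_def f_gamma by linarith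
    also have "H \<gamma> < H a"
      using incr assms by blast
    finally show ?thesis .
  qed
qed

lemma amplitudesD:
  assumes "a \<in> amplitudes"
  shows "\<gamma> < a" "0 < a" "0 \<le> F a" "f 0 = 0 \<Longrightarrow> 0 < F a" "F a = 0 \<Longrightarrow> f 0 < 0"
  using assms \<gamma> f_0_nonpos by (auto simp: amplitudes_def)

lemma F_le:
  assumes "a \<in> amplitudes" "0 \<le> u" "u \<le> a"
  shows "F u \<le> F a"
  using F_less[of a u] amplitudesD[OF assms(1)] assms(2,3) by (cases "u = 0"; cases "u = a") auto

lemma gap_pos:
  assumes "a \<in> amplitudes" "0 < s" "s < 1"
  shows "0 < gap a s"
  using F_less[of a "a * s"] amplitudesD[OF assms(1)] assms by (simp add: gap_def)

lemma gap_DERIV: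
  assumes "0 < a" "0 < s"
  shows "((\<lambda>a. gap a s) has_real_derivative (H a - H (a * s)) / a powr (p + 1)) (at a)"
proof -
  have "((\<lambda>a. gap a s) has_real_derivative
      ((f a - f (a * s) * s) * a powr p - (F a - F (a * s)) * (p * a powr (p - 1)))
        / (a powr p * a powr p)) (at a)"
    unfolding gap_def using assms
    by (auto intro!: derivative_eq_intros F_DERIV DERIV_chain2[of F] simp: powr_diff)
  also have "((f a - f (a * s) * s) * a powr p - (F a - F (a * s)) * (p * a powr (p - 1)))
        / (a powr p * a powr p) = (H a - H (a * s)) / a powr (p + 1)"
    using assms by (simp add: H_def powr_add powr_diff field_simps)
  finally show ?thesis .
qed

lemma gap_strict_mono:
  assumes "\<gamma> < a" "a < b" "0 < s" "s < 1"
  shows "gap a s < gap b s"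
proof (rule DERIV_pos_imp_increasing[OF \<open>a < b\<close>])
  fix x assume x: "a \<le> x" "x \<le> b"
  then have "x > 0" "H (x * s) < H x"
    using assms \<gamma> by (auto intro!: H_less)
  then show "\<exists>y. ((\<lambda>a. gap a s) has_real_derivative y) (at x) \<and> 0 < y"
    using gap_DERIV[of x s] assms by force
qed

text \<open>The gap is \<open>(a - a s) f(\<xi>)\<close> for some \<open>\<xi> > a s\<close>, and \<open>f(\<xi>)\<close> is at least of order \<open>a powr q\<close>; dividing by
  \<open>a\<^sup>p\<close> leaves \<open>a powr (q + 1 - p)\<close>, a positive power.\<close>

lemma gap_at_top:
  assumes "0 < s" "s < 1"
  shows "filterlim (\<lambda>a. gap a s) at_top at_top"
proof -
  obtain q L where q: "q > p - 1" and L: "L > 0" and lim: "((\<lambda>u. f u / u powr q) \<longlongrightarrow> L) at_top"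
    using f_growth by blast
  have "\<forall>\<^sub>F u in at_top. L / 2 < f u / u powr q"
    using order_tendstoD(1)[OF lim, of "L / 2"] L by simp
  then obtain M where M: "\<And>u. u \<ge> M \<Longrightarrow> L / 2 < f u / u powr q"
    by (auto simp: eventually_at_top_linorder)
  have f_ge: "L / 2 * u powr q \<le> f u" if "u \<ge> max M 1" for u
    using M[of u] that by (simp add: field_simps)
  define C where "C = L / 2 * s powr q * (1 - s)"
  have "C > 0"
    using L assms by (simp add: C_def)
  have "\<forall>\<^sub>F a in at_top. C * a powr (q + 1 - p) \<le> gap a s"
    using eventually_ge_at_top[of "max 1 (max M 1 / s)"]
  proof eventually_elim
    case (elim a)
    have "max M 1 / s \<le> a" "a > 0" using elim by auto
    then have as: "a * s \<ge> max M 1"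
      using assms by (simp add: pos_divide_le_eq)
    have "a * s < a" using assms \<open>a > 0\<close> by simp
    then have "\<exists>z>a * s. z < a \<and> F a - F (a * s) = (a - a * s) * f z"
      using as by (intro MVT2 F_DERIV) auto
    then obtain z where z: "a * s < z" "z < a" "F a - F (a * s) = (a - a * s) * f z"
      by blast
    have "L / 2 * (a * s) powr q \<le> L / 2 * z powr q \<or> q < 0"
      using z as L by (auto intro!: powr_mono2)
    moreover have "q > 0" using q p by simp
    ultimately have "L / 2 * (a * s) powr q \<le> f z"
      using f_ge[of z] z as by auto
    then have "(a - a * s) * (L / 2 * (a * s) powr q) \<le> F a - F (a * s)"
      using z by (auto intro!: mult_left_mono)
    then have "(a - a * s) * (L / 2 * (a * s) powr q) / a powr p \<le> gap a s"
      unfolding gap_def by (rule divide_right_mono) auto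
    also have "(a - a * s) * (L / 2 * (a * s) powr q) / a powr p = C * a powr (q + 1 - p)"
      using \<open>a > 0\<close> assms by (simp add: C_def powr_mult powr_add powr_diff field_simps)
    finally show ?case .
  qed
  moreover have "filterlim (\<lambda>a. C * a powr (q + 1 - p)) at_top at_top"
  proof -
    have "filterlim (\<lambda>a. C * exp ((q + 1 - p) * ln a)) at_top at_top"
      using \<open>C > 0\<close> q
      by (intro filterlim_tendsto_pos_mult_at_top[OF tendsto_const]
            filterlim_compose[OF exp_at_top] ln_at_top) auto
    moreover have "\<forall>\<^sub>F a in at_top. C * exp ((q + 1 - p) * ln a) = C * a powr (q + 1 - p)"
      using eventually_gt_at_top[of 0] by eventually_elim (simp add: powr_def)
    ultimately show ?thesis
      by (simp cong: filterlim_cong)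
  qed
  ultimately show ?thesis
    by (rule filterlim_at_top_mono[rotated])
qed

lemma gap_continuous_amplitude:
  assumes "0 < a" "0 < s"
  shows "isCont (\<lambda>a. gap a s) a"
  using gap_DERIV[OF assms] DERIV_isCont by blast

lemma gap_continuous:
  assumes "0 < a"
  shows "continuous_on {0..1} (gap a)"
  unfolding gap_def
  using assms by (auto intro!: continuous_intros continuous_on_compose2[OF F_continuous])

text \<open>Since the gap at \<open>s = 1/2\<close> tends to infinity and \<open>F(a/2) > F(\<gamma>)\<close>, \<open>F\<close> becomes positive.\<close>

lemma exists_zero_of_F: "\<exists>\<theta>>\<gamma>. F \<theta> = 0"
proof -
  have "\<forall>\<^sub>F a in at_top. gap a (1 / 2) \<ge> - F \<gamma>"
    using gap_at_top[of "1 / 2"] by (auto simp: filterlim_at_top)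
  moreover have "\<forall>\<^sub>F a in at_top. a > 2 * \<gamma> \<and> a \<ge> (1::real)"
    by (intro eventually_conj eventually_gt_at_top eventually_ge_at_top)
  ultimately have "\<forall>\<^sub>F a in at_top. gap a (1 / 2) \<ge> - F \<gamma> \<and> a > 2 * \<gamma> \<and> a \<ge> 1"
    by eventually_elim auto
  then obtain a where a: "gap a (1 / 2) \<ge> - F \<gamma>" "a > 2 * \<gamma>" "a \<ge> 1"
    using eventually_happens'[OF trivial_limit_at_top_linorder] by blast
  have "F \<gamma> < 0"
    using F_decreasing[of 0 \<gamma>] \<gamma> by simp
  have "- F \<gamma> \<le> - F \<gamma> * a powr p"
    using \<open>F \<gamma> < 0\<close> a(3) p mult_left_mono[of 1 "a powr p" "- F \<gamma>"] by (simp add: ge_one_powr_ge_zero)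
  also have "\<dots> \<le> F a - F (a / 2)"
    using a by (simp add: gap_def field_simps)
  finally have "F a \<ge> - F \<gamma> + F (a / 2)" by simp
  moreover have "F \<gamma> < F (a / 2)"
    using a by (intro F_increasing) auto
  ultimately have "0 \<le> F a" by simp
  then obtain x where "\<gamma> \<le> x" "x \<le> a" "F x = 0"
    using IVT'[of F \<gamma> 0 a] \<open>F \<gamma> < 0\<close> a \<gamma> continuous_on_subset[OF F_continuous, of "{\<gamma>..a}"]
    by auto
  then show ?thesis
    using \<open>F \<gamma> < 0\<close> by (intro exI[of _ x]) (auto simp: less_le)
qed

definition \<theta> :: real where
  "\<theta> = (SOME x. \<gamma> < x \<and> F x = 0)"

lemma theta: "\<gamma> < \<theta>" "F \<theta> = 0"
  using someI_ex[of "\<lambda>x. \<gamma> < x \<and> F x = 0"] exists_zero_of_F by (auto simp: \<theta>_def)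

lemma amplitudes_eq: "amplitudes = (if f 0 < 0 then {\<theta>..} else {\<theta><..})"
proof -
  have "0 \<le> F a \<longleftrightarrow> \<theta> \<le> a" "0 < F a \<longleftrightarrow> \<theta> < a" if "\<gamma> < a" for a
    using F_increasing[of a \<theta>] F_increasing[of \<theta> a] that theta
    by (cases "a < \<theta>"; cases "a = \<theta>"; force)+
  then show ?thesis
    using theta(1) f_0_nonpos by (auto simp: amplitudes_def dest: order.strict_trans order.strict_trans1 less_imp_le)
qed

lemma amplitudes_upward: "a \<in> amplitudes \<Longrightarrow> a \<le> b \<Longrightarrow> b \<in> amplitudes"
  by (auto simp: amplitudes_eq split: if_splits)

end

section \<open>The time map\<close>

text \<open>The singularities of the time map are those of \<open>t powr (-1/p)\<close>: at each end of \<open>[0, 1]\<close> the gap is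
  either positive or has a simple zero, so it dominates a multiple of the distance to that end.\<close>

lemma linear_lower_bound:
  fixes h :: "real \<Rightarrow> real"
  assumes d: "0 < d" and cont: "continuous_on {0..d} h"
    and pos: "\<And>t. 0 < t \<Longrightarrow> t \<le> d \<Longrightarrow> 0 < h t"
    and at0: "0 < h 0 \<or> h 0 = 0 \<and> (\<exists>D>0. (h has_real_derivative D) (at 0 within {0..d}))"
  shows "\<exists>m>0. \<forall>t\<in>{0..d}. m * t \<le> h t"
proof -
  have compact_bound: "\<exists>m>0. \<forall>t\<in>{e..d}. m * t \<le> h t" if e: "0 \<le> e" "e \<le> d" "0 < h e" for e
  proof -
    have "continuous_on {e..d} h"
      using cont e by (auto intro: continuous_on_subset)
    then obtain s where s: "s \<in> {e..d}" "\<And>t. t \<in> {e..d} \<Longrightarrow> h s \<le> h t"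
      using continuous_attains_inf[of "{e..d}" h] e by auto
    have "0 < h s"
      using s(1) e pos[of s] by (cases "s = e") auto
    moreover have "h s / d * t \<le> h t" if "t \<in> {e..d}" for t
    proof -
      have "h s / d * t \<le> h s"
        using that d \<open>0 < h s\<close> by (simp add: field_simps)
      then show ?thesis using s(2)[OF that] by simp
    qed
    ultimately show ?thesis
      using d by (intro exI[of _ "h s / d"]) auto
  qed
  show ?thesis
  proof (cases "0 < h 0")
    case True
    then show ?thesis using compact_bound[of 0] d by auto
  next
    case False
    then obtain D where D: "D > 0" "(h has_real_derivative D) (at 0 within {0..d})" and "h 0 = 0"
      using at0 by blast
    have "((\<lambda>t. h t - D / 2 * t) has_real_derivative D / 2) (at 0 within {0..d})"
      using D(2) by (auto intro!: derivative_eq_intros)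
    from has_real_derivative_pos_inc_right[OF this] D(1)
    obtain e where e: "e > 0" "\<And>t. t > 0 \<Longrightarrow> t \<in> {0..d} \<Longrightarrow> t < e \<Longrightarrow> 0 < h t - D / 2 * t"
      using \<open>h 0 = 0\<close> by auto
    define e' where "e' = min d (e / 2)"
    have e': "0 < e'" "e' \<le> d" "e' < e" using e d by (auto simp: e'_def)
    obtain m where m: "m > 0" "\<And>t. t \<in> {e'..d} \<Longrightarrow> m * t \<le> h t"
      using compact_bound[of e'] pos[of e'] e' by auto
    have "min m (D / 2) * t \<le> h t" if t: "t \<in> {0..d}" for t
    proof (cases "t \<ge> e'")
      case True
      have "min m (D / 2) * t \<le> m * t"
        using t by (intro mult_right_mono) auto
      then show ?thesis using m(2)[of t] True t by auto
    next
      case False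
      have "min m (D / 2) * t \<le> D / 2 * t"
        using t by (intro mult_right_mono) auto
      also have "D / 2 * t \<le> h t"
        using e(2)[of t] False e' t \<open>h 0 = 0\<close> by (cases "t = 0") auto
      finally show ?thesis .
    qed
    then show ?thesis
      using m(1) D(1) by (intro exI[of _ "min m (D / 2)"]) auto
  qed
qed

lemma powr_integrable_of_linear_lower_bound:
  fixes h :: "real \<Rightarrow> real"
  assumes d: "0 < d" and cont: "continuous_on {0..d} h"
    and pos: "\<And>t. 0 < t \<Longrightarrow> t \<le> d \<Longrightarrow> 0 < h t"
    and at0: "0 < h 0 \<or> h 0 = 0 \<and> (\<exists>D>0. (h has_real_derivative D) (at 0 within {0..d}))"
    and r: "0 < r" "r < 1"
  shows "(\<lambda>t. h t powr (- r)) integrable_on {0..d}"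
proof -
  obtain m where m: "m > 0" "\<And>t. t \<in> {0..d} \<Longrightarrow> m * t \<le> h t"
    using linear_lower_bound[OF d cont pos at0] by blast
  have "(\<lambda>t. h t powr (- r)) integrable_on {0<..d}"
  proof (rule measurable_bounded_by_integrable_imp_integrable_real)
    show "(\<lambda>t. h t powr (- r)) \<in> borel_measurable (lebesgue_on {0<..d})"
    proof (rule continuous_imp_measurable_on_sets_lebesgue)
      show "continuous_on {0<..d} (\<lambda>t. h t powr (- r))"
        using pos by (intro continuous_intros continuous_on_subset[OF cont]) (auto simp: less_le)
    qed auto
    have "(\<lambda>t. m powr (- r) * t powr (- r)) integrable_on {0..d}"
      using has_integral_powr_from_0[of "- r" d] d r
      by (intro integrable_on_mult_right) (auto simp: has_integral_integrable)
    then show "(\<lambda>t. m powr (- r) * t powr (- r)) integrable_on {0<..d}"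
      by (rule integrable_spike_set[of _ "{0..d}"])
         (auto intro: negligible_subset[of "{0}"])
    fix t assume t: "t \<in> {0<..d}"
    have "\<bar>h t powr (- r)\<bar> \<le> (m * t) powr (- r)"
      using t m r by (auto intro!: powr_mono2')
    then show "\<bar>h t powr (- r)\<bar> \<le> m powr (- r) * t powr (- r)"
      using t m by (simp add: powr_mult)
  qed auto
  then show ?thesis
    by (rule integrable_spike_set) (auto intro: negligible_subset[of "{0}"])
qed

context p_laplace_nonlinearity
begin

text \<open>Time per unit of relative height \<open>s = u/a\<close>, up to a factor depending on \<open>\<lambda>\<close> alone.\<close>

definition density :: "real \<Rightarrow> real \<Rightarrow> real" where
  "density a s = gap a s powr (- (1 / p))"

text \<open>The time, in the same units, to fall from the top to relative height \<open>v\<close>.\<close>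

definition travel :: "real \<Rightarrow> real \<Rightarrow> real" where
  "travel a v = integral {v..1} (density a)"

definition time_map :: "real \<Rightarrow> real" where
  "time_map a = travel a 0"

lemma gap_DERIV_within:
  assumes "0 < a" "0 \<le> s"
  shows "((\<lambda>s. gap a s) has_real_derivative - (a * f (a * s)) / a powr p) (at s within {0..})"
proof -
  have "(F has_real_derivative f (a * s)) (at (a * s) within (*) a ` {0..})"
    using assms by (intro DERIV_subset[OF F_DERIV_within]) auto
  moreover have "((*) a has_real_derivative a) (at s within {0..})"
    by (auto intro!: derivative_eq_intros)
  ultimately have "((\<lambda>s. F (a * s)) has_real_derivative f (a * s) * a) (at s within {0..})"
    using DERIV_image_chain[of F "f (a * s)" "(*) a" s "{0..}" a] by (simp add: o_def)
  then show ?thesis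
    unfolding gap_def using assms by (auto intro!: derivative_eq_intros)
qed

text \<open>Near \<open>s = 1\<close> the gap has slope \<open>-a f(a) / a\<^sup>p < 0\<close>. The statement includes \<open>a = \<theta>\<close> also when \<open>f(0) = 0\<close>,
  where the density is not integrable down to \<open>0\<close>.\<close>

lemma density_integrable_right:
  assumes a: "\<gamma> < a" "0 \<le> F a" and c: "0 < c" "c < 1"
  shows "(density a) integrable_on {c..1}"
proof -
  have a0: "0 < a" using a \<gamma> by simp
  have "(\<lambda>t. gap a (1 - t) powr (- (1 / p))) integrable_on {0..1 - c}"
  proof (rule powr_integrable_of_linear_lower_bound)
    show "continuous_on {0..1 - c} (\<lambda>t. gap a (1 - t))"
      using c by (intro continuous_on_compose2[OF gap_continuous[OF a0]] continuous_intros) auto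
    show "0 < gap a (1 - t)" if "0 < t" "t \<le> 1 - c" for t
    proof -
      have "F (a * (1 - t)) < F a"
        using a a0 that c by (intro F_less) auto
      then show ?thesis using a0 by (simp add: gap_def)
    qed
    have "((\<lambda>s. gap a s) has_real_derivative - (a * f (a * 1)) / a powr p) (at 1)"
      using gap_DERIV_within[OF a0, of 1] at_within_interior[of 1 "{0::real..}"]
      by (simp add: interior_real_atLeast)
    moreover have "((\<lambda>t. 1 - t) has_real_derivative - 1) (at (0::real))"
      by (auto intro!: derivative_eq_intros)
    ultimately have "((\<lambda>t. gap a (1 - t)) has_real_derivative
        - (a * f (a * 1)) / a powr p * - 1) (at 0)"
      by (intro DERIV_chain2[of "gap a" _ "\<lambda>t. 1 - t" 0 "- 1" UNIV]) simp_all
    then have "((\<lambda>t. gap a (1 - t)) has_real_derivative (a * f a) / a powr p) (at 0)"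
      by simp
    then have "((\<lambda>t. gap a (1 - t)) has_real_derivative (a * f a) / a powr p) (at 0 within {0..1 - c})"
      by (rule has_field_derivative_at_within)
    moreover have "(a * f a) / a powr p > 0"
      using a0 f_pos[OF a(1)] by simp
    ultimately show "0 < gap a (1 - 0) \<or> gap a (1 - 0) = 0 \<and>
        (\<exists>D>0. ((\<lambda>t. gap a (1 - t)) has_real_derivative D) (at 0 within {0..1 - c}))"
      by (auto simp: gap_def)
  qed (use c p in auto)
  then have "(\<lambda>t. density a (1 - t)) integrable_on cbox 0 (1 - c)"
    by (simp add: density_def)
  from integrable_affinity[OF this, of "-1" 1] show ?thesis
    using c by simp
qed

text \<open>Near \<open>s = 0\<close> the gap is positive if \<open>F a > 0\<close>; otherwise \<open>f(0) < 0\<close> and it has slope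
  \<open>-a f(0) / a\<^sup>p > 0\<close>.\<close>

lemma density_integrable:
  assumes a: "a \<in> amplitudes"
  shows "(density a) integrable_on {0..1}"
proof -
  have a0: "0 < a" using amplitudesD[OF a] by simp
  have "(\<lambda>t. gap a t powr (- (1 / p))) integrable_on {0..1 / 2}"
  proof (rule powr_integrable_of_linear_lower_bound)
    show "continuous_on {0..1 / 2} (gap a)"
      by (rule continuous_on_subset[OF gap_continuous[OF a0]]) auto
    show "0 < gap a t" if "0 < t" "t \<le> 1 / 2" for t
      using gap_pos[OF a] that by auto
    have "(gap a has_real_derivative - (a * f 0) / a powr p) (at 0 within {0..1 / 2})"
      using DERIV_subset[OF gap_DERIV_within[OF a0 order.refl], of "{0..1 / 2}"] by simp
    moreover have "- (a * f 0) / a powr p > 0" if "F a = 0"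
      using amplitudesD(5)[OF a that] a0 by (simp add: mult_pos_neg divide_neg_pos)
    ultimately have "F a = 0 \<Longrightarrow> \<exists>D>0. (gap a has_real_derivative D) (at 0 within {0..1 / 2})"
      by blast
    then show "0 < gap a 0 \<or> gap a 0 = 0 \<and>
        (\<exists>D>0. (gap a has_real_derivative D) (at 0 within {0..1 / 2}))"
      using amplitudesD(3)[OF a] a0 by (cases "F a = 0") (auto simp: gap_def)
  qed (use p in auto)
  then have "(density a) integrable_on {0..1 / 2}"
    by (simp add: density_def[abs_def])
  moreover have "(density a) integrable_on {1 / 2..1}"
    using density_integrable_right[of a "1 / 2"] amplitudesD[OF a] by simp
  ultimately show ?thesis
    by (rule Henstock_Kurzweil_Integration.integrable_combine[rotated 2]) auto
qed

lemma density_pos: "a \<in> amplitudes \<Longrightarrow> 0 < s \<Longrightarrow> s < 1 \<Longrightarrow> 0 < density a s"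
  using gap_pos[of a s] by (simp add: density_def)

lemma density_strict_antimono:
  assumes "a \<in> amplitudes" "a < b" "0 < s" "s < 1"
  shows "density b s < density a s"
  unfolding density_def using gap_strict_mono[of a b s] gap_pos[of a s] amplitudesD[OF assms(1)] assms p
  by (intro powr_less_mono2_neg) auto

lemma travel_1 [simp]: "travel a 1 = 0"
  by (simp add: travel_def)

lemma travel_eq:
  assumes "a \<in> amplitudes" "v \<in> {0..1}"
  shows "travel a v = time_map a - integral {0..v} (density a)"
  using Henstock_Kurzweil_Integration.integral_combine[of 0 v 1 "density a"] density_integrable assms
  by (simp add: travel_def time_map_def)

lemma travel_continuous:
  assumes a: "a \<in> amplitudes"
  shows "continuous_on {0..1} (travel a)"
proof -
  have "continuous_on {0..1} (\<lambda>v. time_map a - integral {0..v} (density a))"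
    by (intro continuous_intros indefinite_integral_continuous_1 density_integrable a)
  then show ?thesis
    by (rule continuous_on_eq) (simp add: travel_eq[OF a])
qed

lemma density_isCont:
  assumes a: "a \<in> amplitudes" and v: "0 < v" "v < 1"
  shows "isCont (density a) v"
proof -
  have "isCont (gap a) v"
    using gap_continuous[of a] amplitudesD[OF a] v
    by (intro continuous_on_interior[of "{0..1}"]) (auto simp: interior_atLeastAtMost_real)
  then show ?thesis
    unfolding density_def using gap_pos[OF a v] by (intro continuous_intros) auto
qed

lemma travel_DERIV:
  assumes a: "a \<in> amplitudes" and v: "0 < v" "v < 1"
  shows "(travel a has_real_derivative - density a v) (at v)"
proof -
  have "((\<lambda>u. integral {0..u} (density a)) has_vector_derivative density a v) (at v within ({0..1} - {}))"
    by (rule integral_has_vector_derivative_continuous_at)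
       (use v density_isCont[OF a v] density_integrable[OF a] in \<open>auto intro: continuous_at_imp_continuous_at_within\<close>)
  then have "((\<lambda>u. integral {0..u} (density a)) has_real_derivative density a v) (at v)"
    using at_within_interior[of v "{0..1}"] v
    by (simp add: has_real_derivative_iff_has_vector_derivative interior_atLeastAtMost_real)
  then have "((\<lambda>u. time_map a - integral {0..u} (density a)) has_real_derivative - density a v) (at v)"
    by (auto intro!: derivative_eq_intros)
  then show ?thesis
    by (rule has_field_derivative_transform_within_open[of _ _ _ "{0<..<1}"])
       (use v in \<open>simp_all add: travel_eq[OF a]\<close>)
qed

lemma travel_strict_decreasing:
  assumes a: "a \<in> amplitudes" and "0 \<le> v" "v < w" "w \<le> 1"
  shows "travel a w < travel a v"
proof (rule DERIV_neg_imp_decreasing_open[OF \<open>v < w\<close>])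
  show "\<exists>y. (travel a has_real_derivative y) (at x) \<and> y < 0" if "v < x" "x < w" for x
    using travel_DERIV[OF a, of x] density_pos[OF a, of x] that assms by force
  show "continuous_on {v..w} (travel a)"
    using assms by (intro continuous_on_subset[OF travel_continuous[OF a]]) auto
qed

lemma time_map_pos: "a \<in> amplitudes \<Longrightarrow> 0 < time_map a"
  using travel_strict_decreasing[of a 0 1] by (simp add: time_map_def)

lemma travel_diff_decreasing:
  assumes a: "a \<in> amplitudes" "a < b" and "0 \<le> v" "v < w" "w \<le> 1"
  shows "travel a w - travel b w < travel a v - travel b v"
proof (rule DERIV_neg_imp_decreasing_open[OF \<open>v < w\<close>, where f = "\<lambda>v. travel a v - travel b v"])
  have b: "b \<in> amplitudes" using amplitudes_upward a by auto
  show "\<exists>y. ((\<lambda>v. travel a v - travel b v) has_real_derivative y) (at x) \<and> y < 0" if "v < x" "x < w" for x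
    using travel_DERIV[OF a(1), of x] travel_DERIV[OF b, of x] density_strict_antimono[OF a, of x] that assms
    by (intro exI[of _ "density b x - density a x"]) (auto intro!: derivative_eq_intros)
  show "continuous_on {v..w} (\<lambda>v. travel a v - travel b v)"
    using assms by (intro continuous_intros continuous_on_subset[OF travel_continuous[OF a(1)]]
        continuous_on_subset[OF travel_continuous[OF b]]) auto
qed

lemma time_map_strict_antimono:
  assumes "a \<in> amplitudes" "a < b"
  shows "time_map b < time_map a"
  using travel_diff_decreasing[OF assms, of 0 1] by (simp add: time_map_def)

text \<open>Since densities decrease in the height, the difference of two travel times is monotone in \<open>v\<close> and so
  largest in modulus at \<open>v = 0\<close>. This makes \<open>travel\<close> jointly continuous as soon as \<open>time_map\<close> is continuous.\<close>

lemma travel_diff_bound: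
  assumes "a \<in> amplitudes" "b \<in> amplitudes" "v \<in> {0..1}"
  shows "\<bar>travel a v - travel b v\<bar> \<le> \<bar>time_map a - time_map b\<bar>"
proof -
  have ineq: "0 \<le> travel a v - travel b v \<and> travel a v - travel b v \<le> time_map a - time_map b" if "a \<in> amplitudes" "a < b" for a b
    using travel_diff_decreasing[OF that, of 0 v] travel_diff_decreasing[OF that, of v 1] assms(3)
    by (cases "v = 0"; cases "v = 1") (auto simp: time_map_def)
  show ?thesis
    using ineq[of a b] ineq[of b a] assms by (cases a b rule: linorder_cases) auto
qed

text \<open>Dominated convergence: by monotonicity in the height the density at \<open>a\<close> dominates all densities at
  larger heights.\<close>

lemma time_map_sequential:
  assumes a: "a \<in> amplitudes" and X: "\<And>n. a \<le> X n"
    and lim: "\<And>s. 0 < s \<Longrightarrow> s < 1 \<Longrightarrow> (\<lambda>n. density (X n) s) \<longlonglongrightarrow> g s"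
  shows "(\<lambda>n. time_map (X n)) \<longlonglongrightarrow> integral {0<..<1} g"
proof -
  have Xa: "X n \<in> amplitudes" for n
    using amplitudes_upward[OF a X] .
  have int: "density b integrable_on {0<..<1}" if "b \<in> amplitudes" for b
    using density_integrable[OF that] integrable_on_Icc_iff_Ioo by blast
  have "(\<lambda>n. integral {0<..<1} (density (X n))) \<longlonglongrightarrow> integral {0<..<1} g"
  proof (rule dominated_convergence(2))
    fix n s assume s: "s \<in> {0<..<1::real}"
    show "norm (density (X n) s) \<le> density a s"
      using density_pos[OF Xa, of s n] density_strict_antimono[OF a, of "X n" s] X[of n] s
      by (cases "a = X n") auto
  qed (use int[OF Xa] int[OF a] lim in auto)
  then show ?thesis
    by (simp add: time_map_def travel_def integral_open_interval_real)
qed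

text \<open>Domination works on every half-line \<open>{a..}\<close> of admissible heights. If \<open>f(0) < 0\<close> the set of heights is
  one of these; otherwise it is the union of their interiors.\<close>

lemma time_map_continuous: "continuous_on amplitudes time_map"
proof -
  have ge: "continuous_on {a..} time_map" if a: "a \<in> amplitudes" for a
    unfolding continuous_on_sequentially
  proof (intro ballI allI impI, elim conjE)
    fix b and X :: "nat \<Rightarrow> real" assume b: "b \<in> {a..}" and X: "\<forall>n. X n \<in> {a..}" "X \<longlonglongrightarrow> b"
    have b': "b \<in> amplitudes" using b amplitudes_upward[OF a] by auto
    have "(\<lambda>n. time_map (X n)) \<longlonglongrightarrow> integral {0<..<1} (density b)"
    proof (rule time_map_sequential[OF a])
      fix s :: real assume s: "0 < s" "s < 1"
      have "(\<lambda>n. gap (X n) s) \<longlonglongrightarrow> gap b s"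
        using isCont_tendsto_compose[OF gap_continuous_amplitude X(2)] amplitudesD(2)[OF b'] s by auto
      then show "(\<lambda>n. density (X n) s) \<longlonglongrightarrow> density b s"
        unfolding density_def using gap_pos[OF b' s] by (intro tendsto_intros) auto
    qed (use X in auto)
    then show "(time_map \<circ> X) \<longlonglongrightarrow> time_map b"
      by (simp add: time_map_def travel_def integral_open_interval_real o_def)
  qed
  show ?thesis
  proof (cases "f 0 < 0")
    case True
    then show ?thesis using ge[of \<theta>] by (simp add: amplitudes_eq)
  next
    case False
    have "continuous_on {a<..} time_map" if "a \<in> {\<theta><..}" for a
      using ge[of a] False that by (auto simp: amplitudes_eq intro!: continuous_on_subset[of "{a..}"])
    then have "continuous_on (\<Union>a\<in>{\<theta><..}. {a<..}) time_map"
      by (intro continuous_on_open_UN) auto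
    moreover have "(\<Union>a\<in>{\<theta><..}. {a<..}) = {\<theta><..}"
      using dense by fastforce
    ultimately show ?thesis
      using False by (simp add: amplitudes_eq)
  qed
qed

lemma travel_continuous_joint: "continuous_on (amplitudes \<times> {0..1}) (\<lambda>(a, v). travel a v)"
proof -
  have "((\<lambda>(a, v). travel a v) \<longlongrightarrow> travel b w) (at (b, w) within amplitudes \<times> {0..1})"
    if bw: "b \<in> amplitudes" "w \<in> {0..1}" for b w
  proof -
    let ?net = "at (b, w) within amplitudes \<times> {0..1}"
    have ev: "\<forall>\<^sub>F x in ?net. x \<in> amplitudes \<times> {0..1}"
      by (auto simp: eventually_at_filter)
    have 1: "((\<lambda>x. time_map (fst x)) \<longlongrightarrow> time_map b) ?net"
    proof -
      have "continuous_on (amplitudes \<times> {0..1::real}) (\<lambda>x. time_map (fst x))"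
        by (intro continuous_on_compose2[OF time_map_continuous] continuous_intros) auto
      then show ?thesis using bw by (force simp: continuous_on)
    qed
    have 2: "((\<lambda>x. travel b (snd x)) \<longlongrightarrow> travel b w) ?net"
    proof -
      have "continuous_on (amplitudes \<times> {0..1::real}) (\<lambda>x. travel b (snd x))"
        by (intro continuous_on_compose2[OF travel_continuous[OF bw(1)]] continuous_intros) auto
      then show ?thesis using bw by (force simp: continuous_on)
    qed
    have "((\<lambda>x. \<bar>time_map (fst x) - time_map b\<bar>) \<longlongrightarrow> 0) ?net"
      using tendsto_diff[OF 1 tendsto_const[of "time_map b"]] by (intro tendsto_rabs_zero) simp
    then have "((\<lambda>x. travel (fst x) (snd x) - travel b (snd x)) \<longlongrightarrow> 0) ?net"
      by (rule Lim_null_comparison[rotated])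
         (use ev in \<open>eventually_elim, auto intro!: travel_diff_bound bw\<close>)
    from tendsto_add[OF this 2] have "((\<lambda>x. travel (fst x) (snd x)) \<longlongrightarrow> travel b w) ?net"
      by simp
    then show ?thesis
      by (simp only: case_prod_beta')
  qed
  then show ?thesis
    by (auto simp: continuous_on_def)
qed

lemma time_map_small:
  assumes "e > 0"
  shows "\<exists>a\<in>amplitudes. time_map a < e"
proof -
  define a where "a = \<theta> + 1"
  have a: "a \<in> amplitudes" by (auto simp: a_def amplitudes_eq)
  have "(\<lambda>n. time_map (a + real n)) \<longlonglongrightarrow> integral {0<..<1} (\<lambda>s::real. 0)"
  proof (rule time_map_sequential[OF a])
    fix s :: real assume s: "0 < s" "s < 1"
    have "filterlim (\<lambda>n. gap (a + real n) s) at_top sequentially"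
      by (intro filterlim_compose[OF gap_at_top[OF s]]
            filterlim_tendsto_add_at_top[OF tendsto_const] filterlim_real_sequentially)
    then show "(\<lambda>n. density (a + real n) s) \<longlonglongrightarrow> 0"
      unfolding density_def using p by (intro tendsto_neg_powr) auto
  qed auto
  then have "\<forall>\<^sub>F n in sequentially. time_map (a + real n) < e"
    using assms by (intro order_tendstoD) auto
  then obtain n where "time_map (a + real n) < e"
    using eventually_happens'[OF sequentially_bot] by blast
  then show ?thesis
    using amplitudes_upward[OF a, of "a + real n"] by auto
qed

end

section \<open>Solutions obtained by inverting the time map\<close>

context p_laplace_nonlinearity
begin

text \<open>The relative height after the fraction \<open>t\<close> of the total travel time.\<close>

definition rel_height :: "real \<Rightarrow> real \<Rightarrow> real" where
  "rel_height a t = (SOME v. v \<in> {0..1} \<and> travel a v = t * time_map a)"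

text \<open>The value of \<open>\<lambda>\<close> for which the solution of height \<open>a\<close> falls from the top to \<open>0\<close> in time exactly \<open>1\<close>.\<close>

definition lam :: "real \<Rightarrow> real" where
  "lam a = (p - 1) / p * time_map a powr p"

definition profile :: "real \<Rightarrow> real \<Rightarrow> real" where
  "profile a x = a * rel_height a \<bar>x\<bar>"

text \<open>This is \<open>\<bar>u'\<bar>\<close> as given by the energy identity, since \<open>(p/(p - 1)) lam a\<close> equals
  \<open>time_map a powr p\<close>.\<close>

definition slope :: "real \<Rightarrow> real \<Rightarrow> real" where
  "slope a x = time_map a * (F a - F (profile a x)) powr (1 / p)"

definition sol :: "real \<Rightarrow> real \<Rightarrow> real" where
  "sol a = restrict (profile a) {-1..1}"

lemma travel_inj:
  assumes "a \<in> amplitudes" "v \<in> {0..1}" "w \<in> {0..1}" "travel a v = travel a w"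
  shows "v = w"
proof (cases v w rule: linorder_cases)
  case less
  then show ?thesis using travel_strict_decreasing[of a v w] assms by simp
next
  case greater
  then show ?thesis using travel_strict_decreasing[of a w v] assms by simp
qed

lemma rel_height_works:
  assumes a: "a \<in> amplitudes" and t: "t \<in> {0..1}"
  shows "rel_height a t \<in> {0..1} \<and> travel a (rel_height a t) = t * time_map a"
proof -
  have "\<exists>v\<ge>0. v \<le> 1 \<and> travel a v = t * time_map a"
    using t time_map_pos[OF a] travel_continuous[OF a]
    by (intro IVT2') (auto simp: time_map_def mult_left_le_one_le)
  then have "\<exists>v. v \<in> {0..1} \<and> travel a v = t * time_map a"
    by auto
  then show ?thesis
    unfolding rel_height_def by (rule someI_ex)
qed

lemma rel_height_eqI:
  assumes "a \<in> amplitudes" "v \<in> {0..1}" "travel a v = t * time_map a"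
  shows "rel_height a t = v"
proof -
  have "rel_height a t \<in> {0..1} \<and> travel a (rel_height a t) = t * time_map a"
    unfolding rel_height_def by (rule someI[where x = v]) (use assms(2,3) in simp)
  then show ?thesis
    using travel_inj[OF assms(1), of "rel_height a t" v] assms(2,3) by simp
qed

lemma rel_height_0: "a \<in> amplitudes \<Longrightarrow> rel_height a 0 = 1"
  by (rule rel_height_eqI) auto

lemma rel_height_1: "a \<in> amplitudes \<Longrightarrow> rel_height a 1 = 0"
  by (rule rel_height_eqI) (auto simp: time_map_def)

lemma rel_height_interior:
  assumes a: "a \<in> amplitudes" and t: "0 < t" "t < 1"
  shows "0 < rel_height a t" "rel_height a t < 1"
proof -
  have *: "rel_height a t \<in> {0..1}" "travel a (rel_height a t) = t * time_map a"
    using rel_height_works[OF a, of t] t by auto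
  have "rel_height a t \<noteq> 1"
    using *(2) time_map_pos[OF a] t by (auto simp: less_le)
  moreover have "rel_height a t \<noteq> 0"
    using *(2) time_map_pos[OF a] t by (auto simp: time_map_def[symmetric])
  ultimately show "0 < rel_height a t" "rel_height a t < 1" using *(1) by auto
qed

text \<open>The graph of \<open>rel_height\<close> is cut out by the continuous equation \<open>travel a v = t time_map a\<close>, hence closed; a
  function with closed graph into a compact set is continuous.\<close>

lemma rel_height_continuous_joint: "continuous_on (amplitudes \<times> {0..1}) (\<lambda>(a, t). rel_height a t)"
proof -
  let ?S = "amplitudes \<times> {0..1::real}"
  let ?g = "\<lambda>x. rel_height (fst x) (snd x)"
  define E :: "(real \<times> real) \<times> real \<Rightarrow> real"
    where "E z = travel (fst (fst z)) (snd z) - snd (fst z) * time_map (fst (fst z))" for z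
  have "continuous_on (?S \<times> {0..1}) (\<lambda>z. travel (fst (fst z)) (snd z))"
    by (rule continuous_on_two_arguments[OF travel_continuous_joint]) (auto intro!: continuous_intros)
  then have E: "continuous_on (?S \<times> {0..1}) E"
    unfolding E_def
    by (intro continuous_intros continuous_on_compose2[OF time_map_continuous]) auto
  have "(\<lambda>x. (x, ?g x)) ` ?S = (?S \<times> {0..1}) \<inter> E -` {0}"
  proof (intro set_eqI iffI)
    fix z assume "z \<in> (\<lambda>x. (x, ?g x)) ` ?S"
    then show "z \<in> (?S \<times> {0..1}) \<inter> E -` {0}"
      using rel_height_works by (force simp: E_def)
  next
    fix z assume z: "z \<in> (?S \<times> {0..1}) \<inter> E -` {0}"
    then have "?g (fst z) = snd z"
      by (intro rel_height_eqI) (auto simp: E_def)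
    then show "z \<in> (\<lambda>x. (x, ?g x)) ` ?S"
      using z by (intro image_eqI[of _ _ "fst z"]) (auto simp: prod_eq_iff)
  qed
  moreover have "closedin (top_of_set (?S \<times> {0..1})) ((?S \<times> {0..1}) \<inter> E -` {0})"
    by (rule continuous_closedin_preimage[OF E]) auto
  ultimately have "closedin (top_of_set (?S \<times> {0..1})) ((\<lambda>x. (x, ?g x)) ` ?S)"
    by simp
  moreover have "?g \<in> ?S \<rightarrow> {0..1}"
    using rel_height_works by auto
  ultimately have "continuous_on ?S ?g"
    using continuous_closed_graph_eq[of "{0..1::real}" ?g ?S] by simp
  then show ?thesis
    by (simp add: case_prod_beta')
qed

lemma profile_continuous_joint:
  "continuous_on (amplitudes \<times> {-1..1}) (\<lambda>(a, x). profile a x)"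
proof -
  have "continuous_on (amplitudes \<times> {-1..1}) (\<lambda>z. rel_height (fst z) \<bar>snd z\<bar>)"
    by (rule continuous_on_two_arguments[OF rel_height_continuous_joint]) (auto intro!: continuous_intros)
  then show ?thesis
    by (auto simp: profile_def case_prod_beta' intro!: continuous_intros)
qed

lemma profile_range:
  assumes "a \<in> amplitudes" "x \<in> {-1..1}"
  shows "0 \<le> profile a x" "profile a x \<le> a"
  using rel_height_works[OF assms(1), of "\<bar>x\<bar>"] amplitudesD(2)[OF assms(1)] assms(2)
  by (auto simp: profile_def mult_left_le)

lemma profile_0: "a \<in> amplitudes \<Longrightarrow> profile a 0 = a"
  by (simp add: profile_def rel_height_0)

lemma profile_1: "a \<in> amplitudes \<Longrightarrow> profile a 1 = 0" "a \<in> amplitudes \<Longrightarrow> profile a (-1) = 0"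
  by (simp_all add: profile_def rel_height_1)

lemma profile_interior:
  assumes "a \<in> amplitudes" "x \<in> {-1<..<1}" "x \<noteq> 0"
  shows "0 < profile a x" "profile a x < a"
  using rel_height_interior[OF assms(1), of "\<bar>x\<bar>"] amplitudesD(2)[OF assms(1)] assms(2,3)
  by (auto simp: profile_def)

lemma slope_continuous_joint:
  "continuous_on (amplitudes \<times> {-1..1}) (\<lambda>(a, x). slope a x)"
proof -
  have "continuous_on (amplitudes \<times> {-1..1}) (\<lambda>z. F (profile (fst z) (snd z)))"
    using profile_continuous_joint
    by (intro continuous_on_compose2[OF F_continuous]) (auto simp: case_prod_beta' profile_range)
  moreover have "continuous_on (amplitudes \<times> {-1..1::real}) (\<lambda>z. F (fst z))"
    by (intro continuous_on_compose2[OF F_continuous] continuous_intros) (auto dest: amplitudesD(2))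
  moreover have "continuous_on (amplitudes \<times> {-1..1::real}) (\<lambda>z. time_map (fst z))"
    by (intro continuous_on_compose2[OF time_map_continuous] continuous_intros) auto
  ultimately have "continuous_on (amplitudes \<times> {-1..1})
      (\<lambda>z. time_map (fst z) * (F (fst z) - F (profile (fst z) (snd z))) powr (1 / p))"
    using p F_le by (intro continuous_intros continuous_on_powr') (auto simp: profile_range)
  then show ?thesis
    by (simp add: slope_def case_prod_beta')
qed

lemma rel_height_DERIV:
  assumes a: "a \<in> amplitudes" and t: "0 < t" "t < 1"
  shows "(rel_height a has_real_derivative - time_map a / density a (rel_height a t)) (at t)"
proof -
  have v01: "0 < rel_height a t" "rel_height a t < 1" using rel_height_interior[OF assms] by auto
  have kp: "0 < density a (rel_height a t)" and Tp: "0 < time_map a"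
    using density_pos[OF a v01] time_map_pos[OF a] by auto
  have "(rel_height a has_real_derivative inverse (- density a (rel_height a t) / time_map a)) (at t)"
  proof (rule DERIV_inverse_function[where f = "\<lambda>v. travel a v / time_map a"])
    show "((\<lambda>v. travel a v / time_map a) has_real_derivative - density a (rel_height a t) / time_map a) (at (rel_height a t))"
      by (intro DERIV_cdivide travel_DERIV a v01)
    show "travel a (rel_height a y) / time_map a = y" if "0 < y" "y < 1" for y
      using rel_height_works[OF a, of y] that Tp by simp
    have "continuous_on {0..1} (rel_height a)"
      by (rule continuous_on_section[OF rel_height_continuous_joint a])
    then show "isCont (rel_height a) t"
      using t by (intro continuous_on_interior[of "{0..1}"]) (auto simp: interior_atLeastAtMost_real)
  qed (use kp Tp t in auto)
  then show ?thesis by (simp add: field_simps)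
qed

lemma profile_DERIV:
  assumes a: "a \<in> amplitudes" and x: "x \<in> {-1<..<1}" "x \<noteq> 0"
  shows "(profile a has_real_derivative - sgn x * slope a x) (at x)"
proof -
  let ?v = "rel_height a \<bar>x\<bar>"
  have v01: "0 < ?v" "?v < 1" using rel_height_interior[OF a, of "\<bar>x\<bar>"] x by auto
  have a0: "0 < a" using amplitudesD[OF a] by simp
  have "F (a * ?v) < F a"
    using F_less[of a "a * ?v"] amplitudesD[OF a] v01 by simp
  then have "(gap a ?v) powr (1 / p) = (F a - F (a * ?v)) powr (1 / p) / a"
    using a0 p by (simp add: gap_def powr_divide powr_powr)
  then have slope: "slope a x = a * (time_map a / density a ?v)"
    using a0 by (simp add: density_def slope_def profile_def powr_minus field_simps)
  have "((\<lambda>x. a * rel_height a \<bar>x\<bar>) has_real_derivative a * (- time_map a / density a ?v * sgn x)) (at x)"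
    using x by (intro DERIV_cmult DERIV_chain2[of "rel_height a" _ abs] rel_height_DERIV[OF a] DERIV_abs) auto
  then show ?thesis
    by (simp add: profile_def[abs_def] slope mult_ac)
qed

lemma slope_0: "a \<in> amplitudes \<Longrightarrow> slope a 0 = 0"
  by (simp add: slope_def profile_0)

lemma slope_pos:
  assumes "a \<in> amplitudes" "x \<in> {-1<..<1}" "x \<noteq> 0"
  shows "0 < slope a x"
  using profile_interior[OF assms] F_less[of a "profile a x"] amplitudesD[OF assms(1)] time_map_pos[OF assms(1)]
  by (simp add: slope_def)

lemma slope_signed_continuous:
  assumes a: "a \<in> amplitudes"
  shows "continuous_on {-1..1} (\<lambda>x. - sgn x * slope a x)"
  using continuous_on_minus[OF continuous_on_sgn_mult[of 1 "slope a"]]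
      continuous_on_section[OF slope_continuous_joint a] slope_0[OF a] by simp

lemma profile_derivative:
  assumes a: "a \<in> amplitudes" and x: "x \<in> {-1..1}"
  shows "(profile a has_vector_derivative - sgn x * slope a x) (at x within {-1..1})"
proof (rule C1_up_to_endpoints[of "{0}"])
  show "continuous_on {-1..1} (profile a)"
    by (rule continuous_on_section[OF profile_continuous_joint a])
  show "continuous_on {-1..1} (\<lambda>x. - sgn x * slope a x)"
    by (rule slope_signed_continuous[OF a])
  show "(profile a has_real_derivative - sgn x * slope a x) (at x)" if "x \<in> {-1<..<1} - {0}" for x
    using profile_DERIV[OF a] that by auto
qed (use x in auto)

text \<open>The equation away from \<open>x = 0\<close>: the power \<open>(p - 1)/p - 1\<close> of the gap produced by the chain rule
  cancels the power \<open>1/p\<close> in \<open>slope\<close>.\<close>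

lemma phi_slope_DERIV:
  assumes a: "a \<in> amplitudes" and x: "x \<in> {-1<..<1}" "x \<noteq> 0"
  shows "((\<lambda>x. slope a x powr (p - 1)) has_real_derivative sgn x * (lam a * f (profile a x))) (at x)"
proof -
  let ?D = "\<lambda>x. F a - F (profile a x)"
  have u: "0 < profile a x" "0 < ?D x"
    using profile_interior[OF a x] F_less[of a "profile a x"] amplitudesD[OF a] by auto
  have "(?D has_real_derivative f (profile a x) * (sgn x * slope a x)) (at x)"
    using profile_DERIV[OF a x] u by (auto intro!: derivative_eq_intros DERIV_chain2[of F] F_DERIV)
  then have "((\<lambda>x. time_map a powr (p - 1) * ?D x powr ((p - 1) / p)) has_real_derivative
      time_map a powr (p - 1) * ((p - 1) / p * ?D x powr ((p - 1) / p - 1) * (f (profile a x) * (sgn x * slope a x)))) (at x)"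
    using u(2) DERIV_fun_powr[of ?D _ x "(p - 1) / p"] by (intro DERIV_cmult) auto
  also have "time_map a powr (p - 1) * ((p - 1) / p * ?D x powr ((p - 1) / p - 1) * (f (profile a x) * (sgn x * slope a x)))
      = sgn x * (lam a * f (profile a x))"
  proof -
    have "?D x powr ((p - 1) / p - 1) * ?D x powr (1 / p) = 1"
      using u(2) p by (simp add: powr_add[symmetric] field_simps)
    moreover have "time_map a powr (p - 1) * time_map a = time_map a powr p"
      using time_map_pos[OF a] by (simp add: powr_diff)
    ultimately show ?thesis
      unfolding slope_def lam_def by algebra
  qed
  finally show ?thesis
    using p time_map_pos[OF a] by (simp add: slope_def powr_mult powr_powr)
qed

lemma D1_sol:
  assumes a: "a \<in> amplitudes" and x: "x \<in> {-1..1}"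
  shows "(sol a has_vector_derivative - sgn x * slope a x) (at x within {-1..1})"
    and "D1 (sol a) x = - sgn x * slope a x"
proof -
  show *: "(sol a has_vector_derivative - sgn x * slope a x) (at x within {-1..1})"
    by (rule has_vector_derivative_transform[OF x _ profile_derivative[OF a x]]) (auto simp: sol_def)
  then show "D1 (sol a) x = - sgn x * slope a x"
    using D1_eqI x by blast
qed

lemma sol_positive_solution:
  assumes a: "a \<in> amplitudes"
  shows "positive_solution p f (lam a) (sol a)"
proof -
  have rhs_cont: "continuous_on {-1..1} (\<lambda>x. - (lam a * f (profile a x)))"
    using continuous_on_section[OF profile_continuous_joint a] profile_range[OF a]
    by (intro continuous_intros continuous_on_compose2[OF f_continuous]) auto
  have der: "((\<lambda>x. phi p (D1 (sol a) x)) has_vector_derivative - (lam a * f (profile a x)))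
      (at x within {-1..1})" if x: "x \<in> {-1..1}" for x
  proof -
    have "((\<lambda>x. phi p (- sgn x * slope a x)) has_vector_derivative - (lam a * f (profile a x)))
      (at x within {-1..1})"
    proof (rule C1_up_to_endpoints[of "{0}"])
      show "continuous_on {-1..1} (\<lambda>x. phi p (- sgn x * slope a x))"
        by (intro continuous_on_phi p slope_signed_continuous a)
      show "continuous_on {-1..1} (\<lambda>x. - (lam a * f (profile a x)))"
        by (rule rhs_cont)
      show "((\<lambda>x. phi p (- sgn x * slope a x)) has_real_derivative - (lam a * f (profile a x))) (at x)"
        if "x \<in> {-1<..<1} - {0}" for x
      proof -
        have x: "x \<in> {-1<..<1}" "x \<noteq> 0" using that by auto
        have "((\<lambda>y. - sgn x * slope a y powr (p - 1)) has_real_derivative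
            - sgn x * (sgn x * (lam a * f (profile a x)))) (at x)"
          by (intro DERIV_cmult phi_slope_DERIV a x)
        then have *: "((\<lambda>y. - sgn x * slope a y powr (p - 1)) has_real_derivative
            - (lam a * f (profile a x))) (at x)"
          using x by (simp add: sgn_if split: if_splits)
        define S where "S = (if x > 0 then {0<..<1} else {-1<..<0::real})"
        show ?thesis
        proof (rule has_field_derivative_transform_within_open[OF *, of S])
          show "- sgn x * slope a y powr (p - 1) = phi p (- sgn y * slope a y)" if "y \<in> S" for y
            using that slope_pos[OF a, of y] x(2)
            by (auto simp: S_def phi_eq sgn_mult abs_mult split: if_splits)
        qed (use x in \<open>auto simp: S_def\<close>)
      qed
    qed (use x in auto)
    then show ?thesis
      by (rule has_vector_derivative_transform[OF x, rotated]) (simp add: D1_sol(2)[OF a])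
  qed
  show ?thesis
    unfolding positive_solution_def is_solution_def
  proof (intro conjI ballI)
    show "sol a \<in> extensional {-1..1}" by (simp add: sol_def)
    show "C1_closed (sol a)"
      by (rule C1_closedI[OF slope_signed_continuous[OF a] D1_sol(1)[OF a]])
    show "C1_closed (\<lambda>x. phi p (D1 (sol a) x))"
    proof (rule C1_closedI[OF _ der])
      show "continuous_on {-1..1} (\<lambda>x. - (lam a * f (profile a x)))"
        by (rule rhs_cont)
    qed
    show "D1 (\<lambda>y. phi p (D1 (sol a) y)) x + lam a * f (sol a x) = 0" if "x \<in> {-1<..<1}" for x
      using D1_eqI[OF der, of x] that by (simp add: sol_def)
    show "sol a (- 1) = 0" "sol a 1 = 0"
      by (simp_all add: sol_def profile_1[OF a])
    show "0 < sol a x" if "x \<in> {-1<..<1}" for x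
      using profile_interior[OF a that] amplitudesD(2)[OF a] profile_0[OF a] that
      by (cases "x = 0") (auto simp: sol_def)
  qed
qed

lemma F_lower_bound:
  assumes "f 0 = 0"
  shows "\<exists>c>0. \<exists>s0>0. \<forall>s\<in>{0..s0}. - F s \<le> c * s powr p"
proof -
  obtain c where c: "c > 0" and ev: "\<forall>\<^sub>F s in at_right 0. - f s < c * s powr (p - 1)"
    using f_zero[OF assms] by blast
  then obtain b where b: "b > 0" "\<And>s. 0 < s \<Longrightarrow> s < b \<Longrightarrow> - f s < c * s powr (p - 1)"
    by (auto simp: eventually_at_right_field)
  have "- F s \<le> c / p * s powr p" if s: "s \<in> {0..b / 2}" for s
  proof (cases "s = 0")
    case False
    have "- F s - c / p * s powr p < - F 0 - c / p * 0 powr p"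
    proof (rule DERIV_neg_imp_decreasing_open[of 0 s])
      show "\<exists>y. ((\<lambda>s. - F s - c / p * s powr p) has_real_derivative y) (at x) \<and> y < 0"
        if "0 < x" "x < s" for x
        using b(2)[of x] that s p b(1)
        by (intro exI[of _ "- f x - c * x powr (p - 1)"] conjI)
           (auto intro!: derivative_eq_intros F_DERIV simp: powr_diff field_simps)
      show "continuous_on {0..s} (\<lambda>s. - F s - c / p * s powr p)"
        using p by (intro continuous_intros continuous_on_powr' continuous_on_subset[OF F_continuous]) auto
    qed (use False s in auto)
    then show ?thesis by simp
  qed simp
  then show ?thesis
    using b(1) c p by (intro exI[of _ "c / p"] conjI exI[of _ "b / 2"]) auto
qed

text \<open>As \<open>a\<close> decreases to \<open>\<theta>\<close>, \<open>F a\<close> becomes smaller than \<open>c (\<theta> e)\<^sup>p\<close>, so for \<open>e \<le> s \<le> d\<close> the gap is at most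
  \<open>2 c s\<^sup>p\<close> and the density at least \<open>C/s\<close>. Integrating from \<open>e\<close> to a fixed \<open>d\<close> gives
  \<open>C ln (d/e)\<close>, which exceeds any bound for small \<open>e\<close>.\<close>

lemma time_map_large:
  assumes f0: "f 0 = 0"
  shows "\<exists>a\<in>amplitudes. M < time_map a"
proof -
  obtain c s0 where c: "c > 0" and s0: "s0 > 0" and cs: "\<And>s. s \<in> {0..s0} \<Longrightarrow> - F s \<le> c * s powr p"
    using F_lower_bound[OF f0] by blast
  have \<theta>0: "\<theta> > 0" using theta(1) \<gamma> by simp
  \<comment> \<open>For \<open>a \<le> \<theta> + 1\<close> and \<open>s \<le> d\<close> the point \<open>a s\<close> lies in \<open>{0..s0}\<close>, where the bound on \<open>F\<close> holds.\<close>
  define d where "d = min (s0 / (\<theta> + 1)) (1 / 2)"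
  have d: "0 < d" "d < 1" using s0 \<theta>0 by (auto simp: d_def)
  define C where "C = (2 * c) powr (- (1 / p))"
  have C: "C > 0" using c by (simp add: C_def)
  \<comment> \<open>Chosen so that \<open>C ln (d/e) = \<bar>M\<bar> + 1\<close>.\<close>
  define e where "e = d * exp (- (\<bar>M\<bar> + 1) / C)"
  have e: "0 < e" "e < d" using d C by (auto simp: e_def divide_neg_pos)
  have "\<forall>\<^sub>F a in at_right \<theta>. F a < c * (\<theta> * e) powr p"
  proof (rule order_tendstoD(2))
    have "(F \<longlongrightarrow> F \<theta>) (at \<theta>)"
      using F_DERIV[OF \<theta>0] DERIV_isCont isCont_def by blast
    then show "(F \<longlongrightarrow> 0) (at_right \<theta>)"
      using theta(2) filterlim_at_split by metis
  qed (use c \<theta>0 e in auto)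
  moreover have "\<forall>\<^sub>F a in at_right \<theta>. a \<in> {\<theta><..<\<theta> + 1}"
    by (rule eventually_at_right_real) simp
  ultimately have "\<forall>\<^sub>F a in at_right \<theta>. F a < c * (\<theta> * e) powr p \<and> a \<in> {\<theta><..<\<theta> + 1}"
    by eventually_elim auto
  then obtain a where Fa: "F a < c * (\<theta> * e) powr p" and a1: "\<theta> < a" "a < \<theta> + 1"
    using eventually_happens'[OF trivial_limit_at_right_real] by force
  have a: "a \<in> amplitudes" using a1 f0 by (simp add: amplitudes_eq)
  have a0: "a > 0" using \<theta>0 a1 by simp
  have density_ge: "C / v \<le> density a v" if v: "e < v" "v < d" for v
  proof -
    have v01: "0 < v" "v < 1" using v e d by auto
    have "a * v \<le> (\<theta> + 1) * d" using a1 a0 v v01 by (intro mult_mono) auto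
    also have "\<dots> \<le> s0"
    proof -
      have "d \<le> s0 / (\<theta> + 1)" by (simp add: d_def)
      then show ?thesis using \<theta>0 by (simp add: pos_le_divide_eq mult.commute)
    qed
    finally have "- F (a * v) \<le> c * (a * v) powr p" using cs a0 v01 by simp
    moreover have "(\<theta> * e) powr p \<le> (a * v) powr p"
      using \<theta>0 e a1 v p by (intro powr_mono2 mult_mono) auto
    then have "F a \<le> c * (a * v) powr p" using Fa c mult_left_mono[of "(\<theta> * e) powr p" "(a * v) powr p" c] by linarith
    ultimately have "gap a v \<le> 2 * c * (a * v) powr p / a powr p"
      unfolding gap_def by (intro divide_right_mono) auto
    also have "\<dots> = 2 * c * v powr p"
      using a0 v01 by (simp add: powr_mult)
    finally have "(2 * c * v powr p) powr (- (1 / p)) \<le> density a v"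
      unfolding density_def using gap_pos[OF a v01] p by (intro powr_mono2') auto
    moreover have "(2 * c * v powr p) powr (- (1 / p)) = C / v"
      using c v01 p by (simp add: powr_mult powr_powr C_def powr_minus field_simps)
    ultimately show ?thesis by simp
  qed
  have "travel a d + C * ln d \<le> travel a e + C * ln e"
  proof (rule DERIV_nonpos_imp_decreasing_open[of e d "\<lambda>v. travel a v + C * ln v"])
    show "\<exists>y. ((\<lambda>v. travel a v + C * ln v) has_real_derivative y) (at v) \<and> y \<le> 0"
      if v: "e < v" "v < d" for v
      using density_ge[OF v] travel_DERIV[OF a, of v] v e d
      by (intro exI[of _ "- density a v + C / v"]) (auto intro!: derivative_eq_intros)
    show "continuous_on {e..d} (\<lambda>v. travel a v + C * ln v)"
      using e d by (intro continuous_intros continuous_on_subset[OF travel_continuous[OF a]]) auto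
  qed (use e in auto)
  moreover have "travel a e < time_map a" "0 < travel a d"
    using travel_strict_decreasing[OF a, of 0 e] travel_strict_decreasing[OF a, of d 1] e d by (auto simp: time_map_def)
  moreover have "C * ln d - C * ln e = \<bar>M\<bar> + 1"
    using d C by (simp add: e_def ln_mult field_simps)
  ultimately have "M < time_map a" by linarith
  then show ?thesis using a by blast
qed

text \<open>The time to fall to relative height \<open>e\<close> is bounded by its value at \<open>\<theta>\<close>, while the total time blows
  up; so a given fraction \<open>t\<close> of the total time leads below \<open>e\<close>.\<close>

lemma rel_height_small_near_theta:
  assumes f0: "f 0 = 0" and t: "0 < t" "t \<le> 1" and e: "0 < e" "e < 1"
  shows "\<exists>a1\<in>amplitudes. \<forall>a\<in>amplitudes. a < a1 \<longrightarrow> rel_height a t < e"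
proof -
  obtain a1 where a1: "a1 \<in> amplitudes" "integral {e..1} (density \<theta>) / t < time_map a1"
    using time_map_large[OF f0] by blast
  have "rel_height a t < e" if a: "a \<in> amplitudes" "a < a1" for a
  proof (rule ccontr)
    assume "\<not> rel_height a t < e"
    then have ge: "e \<le> rel_height a t" by simp
    have v01: "rel_height a t \<in> {0..1}" "travel a (rel_height a t) = t * time_map a"
      using rel_height_works[OF a(1), of t] t by auto
    have "t * time_map a \<le> travel a e"
      using travel_strict_decreasing[OF a(1), of e "rel_height a t"] v01 ge e by (cases "e = rel_height a t") auto
    also have "\<dots> \<le> integral {e..1} (density \<theta>)"
      unfolding travel_def
    proof (rule integral_le)
      show "density a integrable_on {e..1}" "density \<theta> integrable_on {e..1}"
        using density_integrable_right[of a e] density_integrable_right[of \<theta> e] amplitudesD[OF a(1)] theta e by auto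
      show "density a s \<le> density \<theta> s" if s: "s \<in> {e..1}" for s
      proof (cases "s = 1")
        case False
        have "\<theta> < a" using a f0 by (simp add: amplitudes_eq)
        moreover have "0 < gap \<theta> s"
          using F_less[of \<theta> "\<theta> * s"] theta \<gamma> s e False by (simp add: gap_def divide_neg_pos)
        ultimately show ?thesis
          unfolding density_def using gap_strict_mono[of \<theta> a s] theta s e False p
          by (intro powr_mono2') auto
      qed (simp add: density_def gap_def)
    qed
    also have "\<dots> < t * time_map a1"
      using a1(2) t by (simp add: field_simps)
    finally have "t * time_map a < t * time_map a1" .
    then show False
      using time_map_strict_antimono[OF a] t by simp
  qed
  then show ?thesis using a1(1) by blast
qed

end

section \<open>Every positive solution comes from the time map\<close>

context p_laplace_nonlinearity
begin

text \<open>Separation of variables on one half of a solution: \<open>w\<close> descends from its maximum at the speed given by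
  the energy. It is applied to \<open>u(x\<^sub>0 + t)\<close> and to \<open>u(x\<^sub>0 - t)\<close>.\<close>

lemma time_along_profile:
  assumes a: "a \<in> amplitudes" and K: "0 < K"
    and cont: "continuous_on {0..d} w" and w0: "w 0 = a"
    and inside: "\<And>t. 0 < t \<Longrightarrow> t < d \<Longrightarrow> 0 < w t \<and> w t < a"
    and range: "\<And>t. t \<in> {0..d} \<Longrightarrow> w t \<in> {0..a}"
    and der: "\<And>t. 0 < t \<Longrightarrow> t < d \<Longrightarrow>
      (w has_real_derivative - ((K * (F a - F (w t))) powr (1 / p))) (at t)"
    and t: "t \<in> {0..d}"
  shows "travel a (w t / a) = K powr (1 / p) * t"
proof -
  have a0: "0 < a" using amplitudesD[OF a] by simp
  define g where "g t = travel a (w t / a) - K powr (1 / p) * t" for t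
  have "g t = g 0"
  proof (rule DERIV_constant_on_Icc[of 0 d g "{}"])
    show "continuous_on {0..d} g"
      unfolding g_def using range a0
      by (intro continuous_intros continuous_on_compose2[OF travel_continuous[OF a]] cont) auto
    show "(g has_real_derivative 0) (at s)" if "s \<in> {0<..<d} - {}" for s
    proof -
      have s: "0 < s" "s < d" using that by auto
      define D where "D = F a - F (w s)"
      have ws: "0 < w s / a" "w s / a < 1" using inside[OF s] a0 by auto
      have D: "0 < D" using F_less[of a "w s"] amplitudesD[OF a] inside[OF s] by (simp add: D_def)
      have "((\<lambda>t. travel a (w t / a)) has_real_derivative
          - density a (w s / a) * (- ((K * D) powr (1 / p)) / a)) (at s)"
        unfolding D_def by (intro DERIV_chain2[of "travel a"] DERIV_cdivide der s travel_DERIV[OF a] ws)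
      moreover have "- density a (w s / a) * (- ((K * D) powr (1 / p)) / a) = K powr (1 / p)"
        using D K a0 p
        by (simp add: density_def gap_def D_def[symmetric] powr_mult powr_divide powr_powr powr_minus field_simps)
      ultimately show ?thesis
        unfolding g_def by (auto intro!: derivative_eq_intros)
    qed
  qed (use t in auto)
  then show ?thesis
    using a0 by (simp add: g_def w0)
qed

text \<open>Let \<open>u\<close> be maximal at \<open>x\<^sub>0\<close>, with value \<open>a\<close>. By the energy identity \<open>u'\<close> vanishes in the interior only
  where \<open>u = a\<close>. There cannot be two such points: an interior minimum between them would be a
  zero of \<open>u'\<close> with \<open>u < a\<close>, and a plateau contradicts the equation, as \<open>f(a) > 0\<close>. So both halves are
  monotone, and both take the time \<open>time_map a\<close>, which puts \<open>x\<^sub>0\<close> in the middle.\<close>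

lemma positive_solution_is_sol:
  assumes l: "0 < l" and pos: "positive_solution p f l u"
  shows "\<exists>a\<in>amplitudes. l = lam a \<and> u = sol a"
proof -
  define v where "v = D1 u"
  define y where "y x = phi p (v x)" for x
  define K where "K = p / (p - 1) * l"
  have K: "0 < K" using p l by (simp add: K_def)
  have sol: "u \<in> extensional {-1..1}" "C1_closed u" "C1_closed y" "u (-1) = 0" "u 1 = 0"
    and eq: "\<And>x. x \<in> {-1<..<1} \<Longrightarrow> D1 y x + l * f (u x) = 0"
    and upos: "\<And>x. x \<in> {-1<..<1} \<Longrightarrow> 0 < u x"
    using pos unfolding positive_solution_def is_solution_def v_def y_def by auto
  have unn: "0 \<le> u x" if "x \<in> {-1..1}" for x
    using upos[of x] sol(4,5) that by (cases "x = -1"; cases "x = 1") auto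
  have ucont: "continuous_on {-1..1} u" and vcont: "continuous_on {-1..1} v"
    and ycont: "continuous_on {-1..1} y"
    using sol(2,3) C1_closed_continuous C1_closed_def v_def by auto
  have uder: "(u has_real_derivative v x) (at x)" if "x \<in> {-1<..<1}" for x
    unfolding v_def by (rule C1_closed_DERIV[OF sol(2) that])
  have yder: "(y has_real_derivative - (l * f (u x))) (at x)" if "x \<in> {-1<..<1}" for x
  proof -
    have "D1 y x = - (l * f (u x))" using eq[OF that] by simp
    then show ?thesis using C1_closed_DERIV[OF sol(3) that] by simp
  qed

  \<comment> \<open>The energy is differentiated through \<open>y\<close>, since \<open>v\<close> need not be differentiable
    where it vanishes.\<close>
  define E where "E x = (p - 1) / p * \<bar>y x\<bar> powr (p / (p - 1)) + l * F (u x)" for x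
  have E_const: "E x = E x'" if "x \<in> {-1..1}" "x' \<in> {-1..1}" for x x'
  proof (rule DERIV_constant_on_Icc[of "-1" 1 E "{}"])
    show "continuous_on {-1..1} E"
      unfolding E_def using p unn
      by (intro continuous_intros continuous_on_powr' ycont
          continuous_on_compose2[OF F_continuous ucont]) auto
    show "(E has_real_derivative 0) (at x)" if "x \<in> {-1<..<1} - {}" for x
    proof -
      have x: "x \<in> {-1<..<1}" using that by simp
      have m: "p / (p - 1) > 1" "p / (p - 1) - 1 = 1 / (p - 1)" using p by (auto simp: field_simps)
      have vx: "sgn (y x) * \<bar>y x\<bar> powr (p / (p - 1) - 1) = v x"
        using phi_inverse[OF p, of "v x"] by (simp add: y_def m(2))
      have "((\<lambda>x. \<bar>y x\<bar> powr (p / (p - 1))) has_real_derivative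
          p / (p - 1) * v x * - (l * f (u x))) (at x)"
        using DERIV_chain2[OF DERIV_abs_powr[OF m(1)] yder[OF x]] unfolding vx .
      then have "((\<lambda>x. (p - 1) / p * \<bar>y x\<bar> powr (p / (p - 1))) has_real_derivative
          (p - 1) / p * (p / (p - 1) * v x * - (l * f (u x)))) (at x)"
        by (rule DERIV_cmult)
      moreover have "(p - 1) / p * (p / (p - 1) * v x * - (l * f (u x))) = - (l * (f (u x) * v x))"
        using p by (simp add: field_simps)
      moreover have "((\<lambda>x. l * F (u x)) has_real_derivative l * (f (u x) * v x)) (at x)"
        by (intro DERIV_cmult DERIV_chain2[of F] F_DERIV upos uder x)
      ultimately show ?thesis
        unfolding E_def using DERIV_add by fastforce
    qed
  qed (use that in auto)

  obtain x0 where x0: "x0 \<in> {-1..1}" and max: "\<And>x. x \<in> {-1..1} \<Longrightarrow> u x \<le> u x0"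
    using continuous_attains_sup[of "{-1..1}" u] ucont by auto
  define a where "a = u x0"
  have a0: "0 < a" using max[of 0] upos[of 0] by (simp add: a_def)
  have x0': "x0 \<in> {-1<..<1}"
    using x0 a0 sol(4,5) a_def by (cases "x0 = -1"; cases "x0 = 1") auto
  have local_max: "v x0 = 0"
  proof (rule DERIV_local_max[OF uder[OF x0'], of "min (1 - x0) (x0 + 1)"])
    show "\<forall>z. \<bar>x0 - z\<bar> < min (1 - x0) (x0 + 1) \<longrightarrow> u z \<le> u x0"
      by (auto intro!: max)
  qed (use x0' in auto)
  have energy: "\<bar>v x\<bar> powr p = K * (F a - F (u x))" if "x \<in> {-1..1}" for x
  proof -
    have "(p - 1) / p * \<bar>v x\<bar> powr p + l * F (u x) = l * F a"
      using E_const[OF that x0] abs_phi_powr[OF p, of "v x"] local_max p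
      by (simp add: E_def y_def a_def)
    then show ?thesis using p by (simp add: K_def field_simps)
  qed
  have Fa: "0 \<le> F a"
  proof -
    have "0 \<le> K * F a" using energy[of 1] sol(5) by (simp flip: powr_ge_zero) (metis powr_ge_zero)
    then show ?thesis using K by (simp add: zero_le_mult_iff)
  qed
  have a\<gamma>: "\<gamma> < a" by (rule F_nonneg_imp_gt_gamma[OF a0 Fa])
  have ule: "u x \<le> a" if "x \<in> {-1..1}" for x using max[OF that] by (simp add: a_def)
  have v_nz: "v x \<noteq> 0" if "x \<in> {-1<..<1}" "u x \<noteq> a" for x
  proof -
    have "F (u x) < F a" using ule[of x] that upos by (intro F_less a\<gamma> Fa) (auto simp: less_le)
    then have "0 < \<bar>v x\<bar> powr p" using energy[of x] that K by simp
    then show ?thesis by auto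
  qed
  have not_two: False
    if x12: "x1 \<in> {-1<..<1}" "x2 \<in> {-1<..<1}" "x1 < x2" and ua: "u x1 = a" "u x2 = a" for x1 x2
  proof (cases "\<exists>z\<in>{x1<..<x2}. u z \<noteq> a")
    case True
    then obtain z where z: "z \<in> {x1<..<x2}" "u z < a"
      using ule x12 by (force simp: less_le)
    have "continuous_on {x1..x2} u"
      using x12 by (intro continuous_on_subset[OF ucont]) auto
    then obtain s where s: "s \<in> {x1..x2}" and smin: "\<And>t. t \<in> {x1..x2} \<Longrightarrow> u s \<le> u t"
      using continuous_attains_inf[of "{x1..x2}" u] x12 by auto
    have us: "u s < a" using smin[of z] z by auto
    then have s': "s \<in> {x1<..<x2}" using s ua by (cases "s = x1"; cases "s = x2") auto
    have s1: "s \<in> {-1<..<1}" using s' x12 by auto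
    have "v s = 0"
    proof (rule DERIV_local_min[OF uder[OF s1], of "min (x2 - s) (s - x1)"])
      show "\<forall>t. \<bar>s - t\<bar> < min (x2 - s) (s - x1) \<longrightarrow> u s \<le> u t"
        by (auto intro!: smin)
    qed (use s' in auto)
    then show False using v_nz[OF s1] us by simp
  next
    case False
    define z where "z = (x1 + x2) / 2"
    have z: "z \<in> {x1<..<x2}" "z \<in> {-1<..<1}" using x12 by (auto simp: z_def)
    have y0: "y x = 0" if "x \<in> {x1<..<x2}" for x
    proof -
      have "\<bar>v x\<bar> powr p = 0" using energy[of x] False that x12 by auto
      then show ?thesis by (simp add: y_def)
    qed
    have "((\<lambda>x. 0) has_real_derivative - (l * f (u z))) (at z)"
      by (rule has_field_derivative_transform_within_open[OF yder[OF z(2)], of "{x1<..<x2}"])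
         (use z y0 in auto)
    then have "- (l * f (u z)) = 0"
      using DERIV_unique DERIV_const by blast
    then show False using l f_pos[OF a\<gamma>] False z by simp
  qed
  have u_lt: "u x < a" if "x \<in> {-1<..<1}" "x \<noteq> x0" for x
  proof -
    have "u x \<noteq> a"
      using not_two[OF that(1) x0' _ _ a_def[symmetric]] not_two[OF x0' that(1) _ a_def[symmetric]] that(2)
      by (meson linorder_neqE)
    moreover have "u x \<le> a" using that by (intro ule) auto
    ultimately show ?thesis by simp
  qed
  have mvt: "\<exists>z>b. z < c \<and> u c - u b = (c - b) * v z" if "-1 \<le> b" "b < c" "c \<le> 1" for b c
  proof -
    have "\<exists>m z. b < z \<and> z < c \<and> (u has_real_derivative m) (at z) \<and> u c - u b = (c - b) * m"
    proof (rule MVT)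
      show "continuous_on {b..c} u"
        using that by (intro continuous_on_subset[OF ucont]) auto
      show "u differentiable (at x)" if "b < x" "x < c" for x
        using uder[of x] that \<open>-1 \<le> b\<close> \<open>c \<le> 1\<close> real_differentiable_def by auto
    qed fact
    then obtain m z where "b < z" "z < c" "(u has_real_derivative m) (at z)" "u c - u b = (c - b) * m"
      by blast
    moreover from this have "m = v z"
      using that by (intro DERIV_unique[OF _ uder[of z]]) auto
    ultimately show ?thesis by blast
  qed
  have v_neg: "v x < 0" if x: "x \<in> {x0<..<1}" for x
  proof (rule ccontr)
    assume "\<not> v x < 0"
    then have vx: "0 < v x" using v_nz[of x] u_lt[of x] x x0' by auto
    obtain z where z: "x < z" "z < 1" "u 1 - u x = (1 - x) * v z"
      using mvt[of x 1] x x0' by auto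
    have "(1 - x) * v z < 0" using z(3) sol(5) upos[of x] x x0' by simp
    then have "v z < 0" using x by (simp add: mult_less_0_iff)
    then obtain s where "x \<le> s" "s \<le> z" "v s = 0"
      using IVT2'[of v z 0 x] vx z x x0' continuous_on_subset[OF vcont, of "{x..z}"] by auto
    then show False using v_nz[of s] u_lt[of s] x x0' z by auto
  qed
  have v_pos: "0 < v x" if x: "x \<in> {-1<..<x0}" for x
  proof (rule ccontr)
    assume "\<not> 0 < v x"
    then have vx: "v x < 0" using v_nz[of x] u_lt[of x] x x0' by auto
    obtain z where z: "-1 < z" "z < x" "u x - u (-1) = (x - (-1)) * v z"
      using mvt[of "-1" x] x x0' by auto
    have "(x + 1) * v z > 0" using z(3) sol(4) upos[of x] x x0' by simp
    then have "v z > 0" using x by (simp add: zero_less_mult_iff)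
    then obtain s where "z \<le> s" "s \<le> x" "v s = 0"
      using IVT2'[of v x 0 z] vx z x x0' continuous_on_subset[OF vcont, of "{z..x}"] by auto
    then show False using v_nz[of s] u_lt[of s] x x0' z by auto
  qed
  have abs_v: "\<bar>v x\<bar> = (K * (F a - F (u x))) powr (1 / p)" if "x \<in> {-1..1}" for x
    using energy[OF that, symmetric] p by (simp add: powr_powr)

  \<comment> \<open>If \<open>F a = 0\<close> and \<open>f(0) = 0\<close>, then \<open>\<bar>u'\<bar> \<le> C u\<close> near \<open>1\<close>, so \<open>u exp (C x)\<close> increases there and \<open>u\<close>
    cannot reach \<open>0\<close>.\<close>
  have "F a \<noteq> 0" if f0: "f 0 = 0"
  proof
    assume Fa0: "F a = 0"
    obtain c s0 where c: "c > 0" and s0: "s0 > 0" and cs: "\<And>s. s \<in> {0..s0} \<Longrightarrow> - F s \<le> c * s powr p"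
      using F_lower_bound[OF f0] by blast
    define C where "C = (K * c) powr (1 / p)"
    have "(u \<longlongrightarrow> 0) (at 1 within {-1..1})"
      using ucont[unfolded continuous_on_def, rule_format, of 1] sol(5) by simp
    then have "\<forall>\<^sub>F x in at 1 within {-1..1}. u x < s0"
      using s0 by (intro order_tendstoD) auto
    then obtain d where d: "d > 0" "\<And>x. x \<in> {-1..1} \<Longrightarrow> x \<noteq> 1 \<Longrightarrow> dist x 1 < d \<Longrightarrow> u x < s0"
      by (auto simp: eventually_at)
    define x1 where "x1 = max ((x0 + 1) / 2) (1 - d / 2)"
    have x1: "x0 < x1" "x1 < 1" "1 - d < x1"
      using x0' d(1) by (auto simp: x1_def less_max_iff_disj)
    have "u x1 * exp (C * x1) \<le> u 1 * exp (C * 1)"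
    proof (rule DERIV_nonneg_imp_increasing_open[of x1 1 "\<lambda>x. u x * exp (C * x)"])
      fix x assume x: "x1 < x" "x < 1"
      have "x \<in> {-1<..<1}" using x x1 x0' by auto
      have "u x < s0" using d(2)[of x] x x1 x0' by (auto simp: dist_real_def)
      then have "- F (u x) \<le> c * u x powr p" using cs[of "u x"] upos[of x] x x1 x0' by auto
      then have "K * (F a - F (u x)) \<le> K * c * u x powr p"
        using mult_left_mono[of "- F (u x)" "c * u x powr p" K] K by (simp add: Fa0 mult.assoc)
      then have "(K * (F a - F (u x))) powr (1 / p) \<le> (K * c * u x powr p) powr (1 / p)"
        using p energy[of x, symmetric] x x1 x0' by (intro powr_mono2) auto
      also have "\<dots> = C * u x"
        using K c p upos[of x] x x1 x0' by (simp add: C_def powr_mult powr_powr)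
      finally have "\<bar>v x\<bar> \<le> C * u x" using abs_v[of x] x x1 x0' by simp
      then have "0 \<le> (v x + C * u x) * exp (C * x)" by simp
      moreover have "((\<lambda>x. u x * exp (C * x)) has_real_derivative (v x + C * u x) * exp (C * x)) (at x)"
        using uder[OF \<open>x \<in> {-1<..<1}\<close>] by (auto intro!: derivative_eq_intros simp: algebra_simps)
      ultimately show "\<exists>y. ((\<lambda>x. u x * exp (C * x)) has_real_derivative y) (at x) \<and> 0 \<le> y"
        by blast
    next
      show "continuous_on {x1..1} (\<lambda>x. u x * exp (C * x))"
        using x1 x0' by (intro continuous_intros continuous_on_subset[OF ucont]) auto
    qed (use x1 in auto)
    then show False using upos[of x1] x1 x0' sol(5) by (auto simp: mult_le_0_iff not_less[symmetric])
  qed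
  then have a: "a \<in> amplitudes"
    using a\<gamma> Fa by (auto simp: amplitudes_def less_le)
  have right: "travel a (u (x0 + t) / a) = K powr (1 / p) * t" if t: "t \<in> {0..1 - x0}" for t
  proof (rule time_along_profile[OF a K, of "1 - x0" "\<lambda>t. u (x0 + t)"])
    show "continuous_on {0..1 - x0} (\<lambda>t. u (x0 + t))"
      using x0' by (intro continuous_on_compose2[OF ucont] continuous_intros) auto
    show "0 < u (x0 + t) \<and> u (x0 + t) < a" if "0 < t" "t < 1 - x0" for t
      using that x0' by (auto intro!: upos u_lt)
    show "u (x0 + t) \<in> {0..a}" if "t \<in> {0..1 - x0}" for t
      using that x0' by (auto intro!: unn ule)
    show "((\<lambda>t. u (x0 + t)) has_real_derivative - ((K * (F a - F (u (x0 + t)))) powr (1 / p))) (at t)"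
      if "0 < t" "t < 1 - x0" for t
    proof -
      have "v (x0 + t) = - ((K * (F a - F (u (x0 + t)))) powr (1 / p))"
        using abs_v[of "x0 + t"] v_neg[of "x0 + t"] that x0' by auto
      moreover have "((\<lambda>t. u (x0 + t)) has_real_derivative v (x0 + t) * (0 + 1)) (at t)"
        using that x0' by (intro DERIV_chain2[of u] uder derivative_intros) auto
      ultimately show ?thesis by simp
    qed
  qed (use t in \<open>auto simp: a_def\<close>)
  have left: "travel a (u (x0 - t) / a) = K powr (1 / p) * t" if t: "t \<in> {0..x0 + 1}" for t
  proof (rule time_along_profile[OF a K, of "x0 + 1" "\<lambda>t. u (x0 - t)"])
    show "continuous_on {0..x0 + 1} (\<lambda>t. u (x0 - t))"
      using x0' by (intro continuous_on_compose2[OF ucont] continuous_intros) auto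
    show "0 < u (x0 - t) \<and> u (x0 - t) < a" if "0 < t" "t < x0 + 1" for t
      using that x0' by (auto intro!: upos u_lt)
    show "u (x0 - t) \<in> {0..a}" if "t \<in> {0..x0 + 1}" for t
      using that x0' by (auto intro!: unn ule)
    show "((\<lambda>t. u (x0 - t)) has_real_derivative - ((K * (F a - F (u (x0 - t)))) powr (1 / p))) (at t)"
      if "0 < t" "t < x0 + 1" for t
    proof -
      have "v (x0 - t) = (K * (F a - F (u (x0 - t)))) powr (1 / p)"
        using abs_v[of "x0 - t"] v_pos[of "x0 - t"] that x0' by auto
      moreover have "((\<lambda>t. u (x0 - t)) has_real_derivative v (x0 - t) * (0 - 1)) (at t)"
        using that x0' by (intro DERIV_chain2[of u] uder derivative_intros) auto
      ultimately show ?thesis by simp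
    qed
  qed (use t in \<open>auto simp: a_def\<close>)
  have TK: "time_map a = K powr (1 / p) * (1 - x0)" "time_map a = K powr (1 / p) * (x0 + 1)"
    using right[of "1 - x0"] left[of "x0 + 1"] x0' sol(4,5) by (auto simp: time_map_def)
  then have "x0 = 0" using K by simp
  then have Ta: "time_map a = K powr (1 / p)" using TK by simp
  have "lam a = l"
    using Ta K p by (simp add: lam_def powr_powr) (simp add: K_def)
  moreover have "u = sol a"
  proof (rule extensionalityI[OF sol(1)])
    show "sol a \<in> extensional {-1..1}" by (simp add: sol_def)
    fix x :: real assume x: "x \<in> {-1..1}"
    have "travel a (u x / a) = \<bar>x\<bar> * time_map a"
      using right[of x] left[of "- x"] x \<open>x0 = 0\<close> Ta by (cases "0 \<le> x") (auto simp: mult.commute)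
    then have "rel_height a \<bar>x\<bar> = u x / a"
      using unn[OF x] ule[OF x] a0 by (intro rel_height_eqI[OF a]) auto
    then show "u x = sol a x"
      using x a0 by (simp add: sol_def profile_def)
  qed
  ultimately show ?thesis using a by blast
qed

end

section \<open>Non-degeneracy\<close>

context p_laplace_nonlinearity
begin

text \<open>The linearized problem on \<open>(0, 1)\<close> along the solution of height \<open>a\<close>, with \<open>z = w'\<close> and flux \<open>g\<close>. Stating
  it for one half only lets the left half be treated by reflection. At \<open>0\<close>, where \<open>\<phi>'(u')\<close> may be
  infinite, the formula for \<open>g\<close> is replaced by continuity.\<close>

definition half_linearized :: "real \<Rightarrow> (real \<Rightarrow> real) \<Rightarrow> (real \<Rightarrow> real) \<Rightarrow> (real \<Rightarrow> real) \<Rightarrow> bool" where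
  "half_linearized a w z g \<longleftrightarrow>
     continuous_on {0..1} w \<and> continuous_on {0..1} z \<and> w 1 = 0 \<and> (g \<longlongrightarrow> g 0) (at_right 0) \<and>
     (\<forall>x. 0 < x \<and> x < 1 \<longrightarrow> (w has_real_derivative z x) (at x) \<and>
        (g has_real_derivative - (lam a * f' (profile a x) * w x)) (at x) \<and>
        g x = (p - 1) * slope a x powr (p - 2) * z x)"

lemma profile_continuous: "a \<in> amplitudes \<Longrightarrow> continuous_on {0..1} (profile a)"
  by (rule continuous_on_subset[OF continuous_on_section[OF profile_continuous_joint]]) auto

lemma slope_continuous: "a \<in> amplitudes \<Longrightarrow> continuous_on {0..1} (slope a)"
  by (rule continuous_on_subset[OF continuous_on_section[OF slope_continuous_joint]]) auto

lemma f_profile_continuous: "a \<in> amplitudes \<Longrightarrow> continuous_on {0..1} (\<lambda>x. f (profile a x))"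
  by (rule continuous_on_compose2[OF f_continuous profile_continuous]) (auto simp: profile_range)

lemma lam_pos: "a \<in> amplitudes \<Longrightarrow> 0 < lam a"
  using time_map_pos[of a] p by (simp add: lam_def)

text \<open>The energy identity.\<close>

lemma slope_powr:
  assumes "a \<in> amplitudes" "x \<in> {-1..1}"
  shows "(p - 1) * slope a x powr p = lam a * (p * (F a - F (profile a x)))"
  using F_le[OF assms(1) profile_range[OF assms]] time_map_pos[OF assms(1)] p
  by (simp add: slope_def lam_def powr_mult powr_powr)

lemma profile_DERIV_right:
  assumes "a \<in> amplitudes" "0 < x" "x < 1"
  shows "(profile a has_real_derivative - slope a x) (at x)"
  using profile_DERIV[OF assms(1), of x] assms(2,3) by simp

text \<open>Here \<open>u'' = - slope'\<close>; the equation for \<open>\<phi>(u')\<close> is solved for \<open>u''\<close>.\<close>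

lemma slope_DERIV_right:
  assumes a: "a \<in> amplitudes" and x: "0 < x" "x < 1"
  shows "(slope a has_real_derivative
      lam a * f (profile a x) / ((p - 1) * slope a x powr (p - 2))) (at x)"
proof -
  have s: "0 < slope a x" using slope_pos[OF a, of x] x by simp
  have "((\<lambda>x. slope a x powr (p - 1)) has_real_derivative lam a * f (profile a x)) (at x)"
    using phi_slope_DERIV[OF a, of x] x by simp
  from DERIV_fun_powr[OF this, of "1 / (p - 1)"]
  have "((\<lambda>x. (slope a x powr (p - 1)) powr (1 / (p - 1))) has_real_derivative
      1 / (p - 1) * (slope a x powr (p - 1)) powr (1 / (p - 1) - 1) * (lam a * f (profile a x))) (at x)"
    using s by simp
  moreover have "(slope a x powr (p - 1)) powr (1 / (p - 1) - 1) = 1 / slope a x powr (p - 2)"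
  proof -
    have "(p - 1) * (1 / (p - 1) - 1) = - (p - 2)" using p by (simp add: field_simps)
    then show ?thesis using s by (simp only: powr_powr powr_minus_divide)
  qed
  ultimately have *: "((\<lambda>x. (slope a x powr (p - 1)) powr (1 / (p - 1))) has_real_derivative
      lam a * f (profile a x) / ((p - 1) * slope a x powr (p - 2))) (at x)"
    by (simp add: mult_ac)
  show ?thesis
  proof (rule has_field_derivative_transform_within_open[OF *, of "{0<..<1}"])
    show "(slope a y powr (p - 1)) powr (1 / (p - 1)) = slope a y" if "y \<in> {0<..<1}" for y
      using slope_pos[OF a, of y] that p by (simp add: powr_powr)
  qed (use x in auto)
qed

text \<open>The left-hand side is the Wronskian of \<open>w\<close> with the solution \<open>u'\<close> of the linearized equation, written
  with \<open>u' = -slope\<close> and \<open>\<phi>'(u') u'' = -\<lambda> f(u)\<close>; its value is read off at \<open>0\<close>. At \<open>x = 1\<close> it tends to a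
  multiple of \<open>slope a 1 powr (p - 1)\<close>, so it is \<open>0\<close> when the slope vanishes there.\<close>

lemma wronskian_constant:
  assumes a: "a \<in> amplitudes" and lin: "half_linearized a w z g" and x: "0 < x" "x < 1"
  shows "lam a * f (profile a x) * w x - g x * slope a x = lam a * f a * w 0"
    and "slope a 1 = 0 \<Longrightarrow> w 0 = 0"
proof -
  define W where "W x = lam a * f (profile a x) * w x - g x * slope a x" for x
  have cont: "continuous_on {0..1} w" "continuous_on {0..1} z" and w1: "w 1 = 0"
    and g0: "(g \<longlongrightarrow> g 0) (at_right 0)"
    and ders: "\<And>x. 0 < x \<Longrightarrow> x < 1 \<Longrightarrow> (w has_real_derivative z x) (at x)"
      "\<And>x. 0 < x \<Longrightarrow> x < 1 \<Longrightarrow> (g has_real_derivative - (lam a * f' (profile a x) * w x)) (at x)"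
    and g: "\<And>x. 0 < x \<Longrightarrow> x < 1 \<Longrightarrow> g x = (p - 1) * slope a x powr (p - 2) * z x"
    using lin by (auto simp: half_linearized_def)
  have fa: "0 < f a" "0 < lam a" using f_pos amplitudesD[OF a] lam_pos[OF a] by auto
  have W_der: "(W has_real_derivative 0) (at x)" if x: "0 < x" "x < 1" for x
  proof -
    let ?s = "slope a x" and ?u = "profile a x"
    have s: "0 < ?s" and u: "0 < ?u" using slope_pos[OF a, of x] profile_interior[OF a, of x] x by auto
    have "(W has_real_derivative
        lam a * (f' ?u * - ?s) * w x + z x * (lam a * f ?u)
        - ((- (lam a * f' ?u * w x)) * ?s + lam a * f ?u / ((p - 1) * ?s powr (p - 2)) * g x)) (at x)"
      unfolding W_def
      by (intro DERIV_diff DERIV_mult DERIV_cmult DERIV_chain2[of f] f_DERIV u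
          profile_DERIV_right slope_DERIV_right a x ders)
    moreover have "lam a * f ?u / ((p - 1) * ?s powr (p - 2)) * g x = lam a * f ?u * z x"
      using g[OF x] s p by simp
    ultimately show ?thesis by (simp add: algebra_simps)
  qed
  have const: "W y = W x" if y: "0 < y" "y < 1" for y
  proof (rule DERIV_constant_on_Icc[of "min x y" "max x y" W "{}"])
    have inside: "0 < t \<and> t < 1" if "t \<in> {min x y..max x y}" for t
      using that x y by (auto simp: min_def max_def split: if_splits)
    show "continuous_on {min x y..max x y} W"
      using inside by (intro DERIV_continuous_on[of _ _ "\<lambda>_. 0"] W_der[THEN has_field_derivative_at_within]) auto
    show "(W has_real_derivative 0) (at t)" if "t \<in> {min x y<..<max x y} - {}" for t
      using inside[of t] that by (intro W_der) auto
  qed auto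
  note lims = tendsto_at_right_of_continuous_on[OF f_profile_continuous[OF a] zero_less_one]
    tendsto_at_right_of_continuous_on[OF cont(1) zero_less_one]
    tendsto_at_right_of_continuous_on[OF slope_continuous[OF a] zero_less_one]
  have "(W \<longlongrightarrow> lam a * f (profile a 0) * w 0 - g 0 * slope a 0) (at_right 0)"
    unfolding W_def by (intro tendsto_intros lims g0)
  moreover have "(W \<longlongrightarrow> W x) (at_right 0)"
  proof (rule tendsto_eventually)
    show "\<forall>\<^sub>F y in at_right 0. W y = W x"
      using eventually_at_right_real[OF zero_less_one] by eventually_elim (auto intro: const)
  qed
  ultimately have W0: "W x = lam a * f a * w 0"
    using tendsto_unique[OF trivial_limit_at_right_real] by (fastforce simp: profile_0[OF a] slope_0[OF a])
  then show "lam a * f (profile a x) * w x - g x * slope a x = lam a * f a * w 0"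
    by (simp add: W_def)
  show "w 0 = 0" if s1: "slope a 1 = 0"
  proof -
    define G where "G y = lam a * f (profile a y) * w y - (p - 1) * slope a y powr (p - 1) * z y" for y
    have "continuous_on {0..1} G"
      unfolding G_def using p slope_continuous[OF a]
      by (intro continuous_intros continuous_on_powr' f_profile_continuous a cont)
         (auto simp: slope_def time_map_pos[OF a] less_imp_le)
    then have "(G \<longlongrightarrow> G 1) (at_left 1)"
      by (rule tendsto_at_left_of_continuous_on) simp
    moreover have "G 1 = 0" using s1 w1 by (simp add: G_def)
    moreover have "(G \<longlongrightarrow> W x) (at_left 1)"
    proof (rule tendsto_eventually)
      show "\<forall>\<^sub>F y in at_left 1. G y = W x"
        using eventually_at_left_real[of 0 "1::real"]
      proof (rule eventually_mono)
        fix y :: real assume "y \<in> {0<..<1}"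
        then have y: "0 < y" "y < 1" by auto
        have "slope a y powr (p - 2) * slope a y = slope a y powr (p - 1)"
          using slope_pos[OF a, of y] y by (simp add: powr_diff power2_eq_square powr_numeral)
        then have "G y = W y" by (simp add: G_def W_def g[OF y] mult_ac)
        then show "G y = W x" using const[OF y] by simp
      qed auto
    qed
    ultimately have "W x = 0"
      using tendsto_unique[OF trivial_limit_at_left_real] by metis
    then show ?thesis using W0 fa by simp
  qed
qed

text \<open>With vanishing Wronskian \<open>w\<close> is a constant multiple of the slope. If the slope is nonzero at \<open>1\<close>, the
  condition \<open>w 1 = 0\<close> makes the multiple zero. If \<open>p > 2\<close>, this follows at \<open>0\<close> instead: a nonzero
  multiple of \<open>u'\<close> is not \<open>C\<^sup>1\<close> there.\<close>

lemma half_linearized_zero: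
  assumes a: "a \<in> amplitudes" and lin: "half_linearized a w z g" and w0: "w 0 = 0"
    and nd: "2 < p \<or> slope a 1 \<noteq> 0" and x: "x \<in> {0..1}"
  shows "w x = 0"
proof -
  have cont: "continuous_on {0..1} w" "continuous_on {0..1} z" and w1: "w 1 = 0"
    and g0: "(g \<longlongrightarrow> g 0) (at_right 0)"
    and wder: "\<And>x. 0 < x \<Longrightarrow> x < 1 \<Longrightarrow> (w has_real_derivative z x) (at x)"
    and g: "\<And>x. 0 < x \<Longrightarrow> x < 1 \<Longrightarrow> g x = (p - 1) * slope a x powr (p - 2) * z x"
    using lin by (auto simp: half_linearized_def)
  have fa: "0 < f a" "0 < lam a" using f_pos amplitudesD[OF a] lam_pos[OF a] by auto
  have W: "g x * slope a x = lam a * f (profile a x) * w x" if "0 < x" "x < 1" for x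
    using wronskian_constant(1)[OF a lin that] w0 by simp
  \<comment> \<open>The point \<open>1/2\<close> is an arbitrary interior point at which the multiple is read off.\<close>
  define \<kappa> where "\<kappa> = w (1 / 2) / slope a (1 / 2)"
  have w_eq: "w x = \<kappa> * slope a x" if x: "0 < x" "x < 1" for x
  proof -
    have der: "((\<lambda>x. w x / slope a x) has_real_derivative 0) (at t)" if t: "0 < t" "t < 1" for t
    proof -
      have s: "0 < slope a t" using slope_pos[OF a, of t] t by simp
      have "((\<lambda>x. w x / slope a x) has_real_derivative
          (z t * slope a t - w t * (lam a * f (profile a t) / ((p - 1) * slope a t powr (p - 2))))
            / (slope a t * slope a t)) (at t)"
        using s by (intro DERIV_divide wder slope_DERIV_right a t) auto
      moreover have "z t * slope a t = w t * (lam a * f (profile a t) / ((p - 1) * slope a t powr (p - 2)))"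
        using W[OF t] g[OF t] s p by (simp add: field_simps)
      ultimately show ?thesis by simp
    qed
    have "w x / slope a x = w (1 / 2) / slope a (1 / 2)"
    proof (rule DERIV_constant_on_Icc[of "min x (1 / 2)" "max x (1 / 2)" "\<lambda>x. w x / slope a x" "{}"])
      have inside: "0 < t \<and> t < 1" if "t \<in> {min x (1 / 2)..max x (1 / 2)}" for t
        using that x by (auto simp: min_def max_def split: if_splits)
      show "continuous_on {min x (1 / 2)..max x (1 / 2)} (\<lambda>x. w x / slope a x)"
      proof (rule DERIV_continuous_on)
        fix t assume "t \<in> {min x (1 / 2)..max x (1 / 2)}"
        then show "((\<lambda>x. w x / slope a x) has_real_derivative 0) (at t within {min x (1 / 2)..max x (1 / 2)})"
          using inside[of t] der[of t] has_field_derivative_at_within by blast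
      qed
      show "((\<lambda>x. w x / slope a x) has_real_derivative 0) (at t)"
        if "t \<in> {min x (1 / 2)<..<max x (1 / 2)} - {}" for t
        using inside[of t] that by (intro der) auto
    qed auto
    then show ?thesis
      using slope_pos[OF a, of x] x by (simp add: \<kappa>_def field_simps)
  qed
  have "\<kappa> = 0"
  proof (cases "slope a 1 = 0")
    case False
    have "((\<lambda>x. w x - \<kappa> * slope a x) \<longlongrightarrow> w 1 - \<kappa> * slope a 1) (at_left 1)"
      by (intro tendsto_intros tendsto_at_left_of_continuous_on[OF _ zero_less_one] cont slope_continuous a)
    moreover have "((\<lambda>x. w x - \<kappa> * slope a x) \<longlongrightarrow> 0) (at_left 1)"
      using eventually_at_left_real[of 0 "1::real"]
      by (intro tendsto_eventually) (auto elim!: eventually_mono simp: w_eq)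
    ultimately have "w 1 - \<kappa> * slope a 1 = 0"
      using tendsto_unique[OF trivial_limit_at_left_real] by metis
    then show ?thesis using w1 False by simp
  next
    case True
    then have p2: "2 < p" using nd by simp
    \<comment> \<open>On the one hand \<open>g\<close> tends to \<open>\<lambda> f(a) \<kappa>\<close>, on the other hand to \<open>\<phi>'(0) w'(0) = 0\<close>.\<close>
    have "((\<lambda>x. lam a * f (profile a x) * \<kappa> - (p - 1) * slope a x powr (p - 2) * z x) \<longlongrightarrow>
        lam a * f (profile a 0) * \<kappa> - (p - 1) * slope a 0 powr (p - 2) * z 0) (at_right 0)"
    proof (rule tendsto_at_right_of_continuous_on[OF _ zero_less_one])
      show "continuous_on {0..1} (\<lambda>x. lam a * f (profile a x) * \<kappa> - (p - 1) * slope a x powr (p - 2) * z x)"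
        using p2 slope_continuous[OF a]
        by (intro continuous_intros continuous_on_powr' f_profile_continuous a cont)
           (auto simp: slope_def time_map_pos[OF a] less_imp_le)
    qed
    moreover have "((\<lambda>x. lam a * f (profile a x) * \<kappa> - (p - 1) * slope a x powr (p - 2) * z x) \<longlongrightarrow> 0) (at_right 0)"
    proof (rule tendsto_eventually)
      show "\<forall>\<^sub>F x in at_right 0. lam a * f (profile a x) * \<kappa> - (p - 1) * slope a x powr (p - 2) * z x = 0"
        using eventually_at_right_real[OF zero_less_one]
      proof (rule eventually_mono)
        fix x :: real assume "x \<in> {0<..<1}"
        then have x: "0 < x" "x < 1" by auto
        have s: "0 < slope a x" using slope_pos[OF a, of x] x by simp
        have "g x * slope a x = lam a * f (profile a x) * \<kappa> * slope a x"
          using W[OF x] unfolding w_eq[OF x] by (simp only: mult.assoc)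
        then have "g x = lam a * f (profile a x) * \<kappa>" using s by simp
        then show "lam a * f (profile a x) * \<kappa> - (p - 1) * slope a x powr (p - 2) * z x = 0"
          using g[OF x] by simp
      qed
    qed
    ultimately have "lam a * f (profile a 0) * \<kappa> - (p - 1) * slope a 0 powr (p - 2) * z 0 = 0"
      by (rule tendsto_unique[OF trivial_limit_at_right_real])
    then show ?thesis using fa by (simp add: profile_0[OF a] slope_0[OF a])
  qed
  then show ?thesis
    using w_eq[of x] w0 w1 x by (cases "x = 0"; cases "x = 1") auto
qed

text \<open>Both \<open>a f(a) - u f(u)\<close> and \<open>F(a) - F(u)\<close> vanish to first order in \<open>a - u\<close>, and
  \<open>F(a) - F(u)\<close> is a multiple of \<open>slope\<^sup>p\<close>; so the quotient is of order \<open>slope powr (p - 1)\<close>.\<close>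

lemma amplitude_defect_limit:
  assumes a: "a \<in> amplitudes"
  shows "((\<lambda>x. (a * f a - profile a x * f (profile a x)) / slope a x) \<longlongrightarrow> 0) (at_right 0)"
proof -
  have a0: "0 < a" and fa: "0 < f a" using amplitudesD[OF a] f_pos by auto
  have "((\<lambda>y. y * f y) has_real_derivative f a + a * f' a) (at a)"
    using f_DERIV[OF a0] by (auto intro!: derivative_eq_intros)
  then have 1: "((\<lambda>y. (y * f y - a * f a) / (y - a)) \<longlongrightarrow> f a + a * f' a) (at a)"
    by (simp add: has_field_derivative_iff)
  have 2: "((\<lambda>y. (F y - F a) / (y - a)) \<longlongrightarrow> f a) (at a)"
    using F_DERIV[OF a0] by (simp add: has_field_derivative_iff)
  have "((\<lambda>y. ((y * f y - a * f a) / (y - a)) / ((F y - F a) / (y - a))) \<longlongrightarrow> (f a + a * f' a) / f a) (at a)"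
    using fa by (intro tendsto_divide 1 2) auto
  moreover have "filterlim (profile a) (at a) (at_right 0)"
  proof (rule filterlim_atI)
    show "(profile a \<longlongrightarrow> a) (at_right 0)"
      using tendsto_at_right_of_continuous_on[OF profile_continuous[OF a]] profile_0[OF a] by simp
    show "\<forall>\<^sub>F x in at_right 0. profile a x \<noteq> a"
      using eventually_at_right_real[OF zero_less_one]
      by eventually_elim (use profile_interior(2)[OF a] in force)
  qed
  ultimately have 3: "((\<lambda>x. ((profile a x * f (profile a x) - a * f a) / (profile a x - a))
      / ((F (profile a x) - F a) / (profile a x - a))) \<longlongrightarrow> (f a + a * f' a) / f a) (at_right 0)"
    by (rule filterlim_compose)
  have "continuous_on {0..1} (\<lambda>x. slope a x powr (p - 1))"
    using p slope_continuous[OF a]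
    by (intro continuous_on_powr' continuous_intros) (auto simp: slope_def time_map_pos[OF a] less_imp_le)
  from tendsto_at_right_of_continuous_on[OF this zero_less_one]
  have 4: "((\<lambda>x. slope a x powr (p - 1)) \<longlongrightarrow> 0) (at_right 0)"
    using p by (simp add: slope_0[OF a])
  \<comment> \<open>With this constant \<open>F a - F u = C slope\<^sup>p\<close>.\<close>
  define C where "C = (p - 1) / (lam a * p)"
  have "((\<lambda>x. ((profile a x * f (profile a x) - a * f a) / (profile a x - a))
      / ((F (profile a x) - F a) / (profile a x - a)) * (C * slope a x powr (p - 1))) \<longlongrightarrow>
      (f a + a * f' a) / f a * (C * 0)) (at_right 0)"
    by (intro tendsto_intros 3 4)
  moreover have "\<forall>\<^sub>F x in at_right 0. ((profile a x * f (profile a x) - a * f a) / (profile a x - a))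
      / ((F (profile a x) - F a) / (profile a x - a)) * (C * slope a x powr (p - 1))
      = (a * f a - profile a x * f (profile a x)) / slope a x"
    using eventually_at_right_real[OF zero_less_one]
  proof (rule eventually_mono)
    fix x :: real assume x: "x \<in> {0<..<1}"
    let ?u = "profile a x" and ?s = "slope a x"
    have u: "0 < ?u" "?u < a" and s: "0 < ?s"
      using profile_interior[OF a, of x] slope_pos[OF a, of x] x by auto
    have D: "0 < F a - F ?u" using F_less[of a ?u] amplitudesD[OF a] u by simp
    have "(p - 1) * ?s powr p = lam a * (p * (F a - F ?u))"
      using slope_powr[OF a, of x] x by auto
    then have "C * ?s powr p = F a - F ?u"
      using p lam_pos[OF a] by (simp add: C_def field_simps)
    then have C: "C * ?s powr (p - 1) = (F a - F ?u) / ?s"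
      using s by (simp add: powr_diff)
    have "((?u * f ?u - a * f a) / (?u - a)) / ((F ?u - F a) / (?u - a)) = (a * f a - ?u * f ?u) / (F a - F ?u)"
    proof -
      have "?u - a \<noteq> 0" using u by simp
      then have "((?u * f ?u - a * f a) / (?u - a)) / ((F ?u - F a) / (?u - a))
          = (?u * f ?u - a * f a) / (F ?u - F a)"
        by simp
      also have "\<dots> = (a * f a - ?u * f ?u) / (F a - F ?u)"
        by (simp flip: minus_divide_divide[of "a * f a - ?u * f ?u"])
      finally show ?thesis .
    qed
    then show "((?u * f ?u - a * f a) / (?u - a)) / ((F ?u - F a) / (?u - a)) * (C * ?s powr (p - 1))
        = (a * f a - ?u * f ?u) / ?s"
      unfolding C using D by simp
  qed
  ultimately show ?thesis
    by (simp add: tendsto_cong)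
qed

text \<open>Variation of parameters: with \<open>c = w(0)/a\<close>, the quotient \<open>r = (w - c u)/slope\<close> removes from \<open>w/slope\<close> the part that is singular at
  \<open>0\<close>. Its derivative is a negative multiple of \<open>H(a) - H(u)\<close>, and \<open>r(1) = 0\<close>, so \<open>r\<close> stays above
  \<open>r(1/2) > 0\<close> near \<open>0\<close>. Up to a vanishing term the flux there is \<open>\<lambda> f(u) r\<close>.\<close>

lemma half_linearized_flux_pos:
  assumes a: "a \<in> amplitudes" and lin: "half_linearized a w z g" and w0: "0 < w 0"
  shows "0 < g 0"
proof -
  have cont: "continuous_on {0..1} w" and w1: "w 1 = 0"
    and g0: "(g \<longlongrightarrow> g 0) (at_right 0)"
    and wder: "\<And>x. 0 < x \<Longrightarrow> x < 1 \<Longrightarrow> (w has_real_derivative z x) (at x)"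
    and g: "\<And>x. 0 < x \<Longrightarrow> x < 1 \<Longrightarrow> g x = (p - 1) * slope a x powr (p - 2) * z x"
    using lin by (auto simp: half_linearized_def)
  have a0: "0 < a" and fa: "0 < f a" "0 < lam a" using f_pos amplitudesD[OF a] lam_pos[OF a] by auto
  define c where "c = w 0 / a"
  have c: "0 < c" using w0 a0 by (simp add: c_def)
  have s1: "slope a 1 \<noteq> 0"
    using wronskian_constant(2)[OF a lin, of "1 / 2"] w0 by auto
  have W: "g x * slope a x = lam a * f (profile a x) * w x - lam a * c * (a * f a)" if "0 < x" "x < 1" for x
    using wronskian_constant(1)[OF a lin that] a0 by (simp add: c_def algebra_simps)
  define r where "r x = (w x - c * profile a x) / slope a x" for x
  have r_der: "(r has_real_derivative - (c * lam a * (H a - H (profile a x)) / ((p - 1) * slope a x powr p))) (at x)"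
    if x: "0 < x" "x < 1" for x
  proof -
    let ?s = "slope a x" and ?u = "profile a x"
    have s: "0 < ?s" using slope_pos[OF a, of x] x by simp
    define Q where "Q = (p - 1) * ?s powr (p - 2)"
    have Q: "0 < Q" using s p by (simp add: Q_def)
    have sp: "(p - 1) * ?s powr p = Q * (?s * ?s)"
      using s by (simp add: Q_def powr_diff power2_eq_square powr_numeral)
    have "(r has_real_derivative
        ((z x - c * - ?s) * ?s - (w x - c * ?u) * (lam a * f ?u / Q)) / (?s * ?s)) (at x)"
      unfolding r_def Q_def using s
      by (intro DERIV_divide DERIV_diff DERIV_cmult wder profile_DERIV_right slope_DERIV_right a x) auto
    moreover have "((z x - c * - ?s) * ?s - (w x - c * ?u) * (lam a * f ?u / Q)) / (?s * ?s)
        = - (c * lam a * (H a - H ?u) / (Q * (?s * ?s)))"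
    proof -
      have "Q * z x * ?s = lam a * f ?u * w x - lam a * c * (a * f a)"
        using W[OF x] g[OF x] by (simp add: Q_def)
      moreover have "Q * (?s * ?s) = lam a * (p * (F a - F ?u))"
        using slope_powr[OF a, of x] x sp by auto
      ultimately have "Q * ((z x - c * - ?s) * ?s) - (w x - c * ?u) * (lam a * f ?u)
          = - (c * lam a * (H a - H ?u))"
        unfolding H_def by algebra
      then have "(Q * ((z x - c * - ?s) * ?s) - (w x - c * ?u) * (lam a * f ?u)) / (Q * (?s * ?s))
          = - (c * lam a * (H a - H ?u)) / (Q * (?s * ?s))"
        by simp
      then show ?thesis using Q s by (simp add: diff_divide_distrib)
    qed
    ultimately show ?thesis by (simp add: sp)
  qed
  have r_decr: "r x > r y" if xy: "0 < x" "x < y" "y \<le> 1" for x y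
  proof (rule DERIV_neg_imp_decreasing_open[OF \<open>x < y\<close>])
    show "\<exists>d. (r has_real_derivative d) (at t) \<and> d < 0" if t: "x < t" "t < y" for t
    proof -
      have t': "0 < t" "t < 1" using t xy by auto
      have "H (profile a t) < H a"
        using H_less[of a "profile a t"] profile_interior[OF a, of t] amplitudesD[OF a] t' by auto
      then have "- (c * lam a * (H a - H (profile a t)) / ((p - 1) * slope a t powr p)) < 0"
        using c fa p slope_pos[OF a, of t] t' by simp
      then show ?thesis using r_der[OF t'] by blast
    qed
    show "continuous_on {x..y} r"
      unfolding r_def
    proof (intro continuous_intros ballI)
      show "continuous_on {x..y} w" "continuous_on {x..y} (profile a)" "continuous_on {x..y} (slope a)"
        using xy by (auto intro: continuous_on_subset[OF cont] continuous_on_subset[OF profile_continuous[OF a]]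
            continuous_on_subset[OF slope_continuous[OF a]])
      show "slope a t \<noteq> 0" if "t \<in> {x..y}" for t
        using slope_pos[OF a, of t] s1 that xy by (cases "t = 1") auto
    qed
  qed
  have r1: "r 1 = 0" by (simp add: r_def w1 profile_1[OF a])
  have r_half: "0 < r (1 / 2)" using r_decr[of "1 / 2" 1] r1 by simp
  have g_eq: "g x = lam a * f (profile a x) * r x
      - c * lam a * ((a * f a - profile a x * f (profile a x)) / slope a x)" if x: "0 < x" "x < 1" for x
  proof -
    have s: "0 < slope a x" using slope_pos[OF a, of x] x by simp
    have "w x = c * profile a x + r x * slope a x" using s by (simp add: r_def)
    then have "g x * slope a x = (lam a * f (profile a x) * r x) * slope a x
        - c * lam a * (a * f a - profile a x * f (profile a x))"
      using W[OF x] by (simp add: algebra_simps)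
    then show ?thesis using s by (simp add: field_simps)
  qed
  have lower: "\<forall>\<^sub>F x in at_right 0. lam a * f (profile a x) * r (1 / 2)
      - c * lam a * ((a * f a - profile a x * f (profile a x)) / slope a x) \<le> g x"
  proof -
    have f_lim: "((\<lambda>x. f (profile a x)) \<longlongrightarrow> f a) (at_right 0)"
      using tendsto_at_right_of_continuous_on[OF f_profile_continuous[OF a]] profile_0[OF a] by simp
    have "\<forall>\<^sub>F x in at_right 0. 0 < f (profile a x)"
      using order_tendstoD(1)[OF f_lim fa(1)] .
    moreover have "\<forall>\<^sub>F x in at_right (0::real). x \<in> {0<..<1 / 2}"
      by (rule eventually_at_right_real) simp
    ultimately show ?thesis
    proof eventually_elim
      case (elim x)
      then have "r (1 / 2) \<le> r x" using r_decr[of x "1 / 2"] by simp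
      then have "lam a * f (profile a x) * r (1 / 2) \<le> lam a * f (profile a x) * r x"
        using elim fa by (intro mult_left_mono) auto
      then show ?case using g_eq[of x] elim by simp
    qed
  qed
  have "((\<lambda>x. lam a * f (profile a x) * r (1 / 2)
      - c * lam a * ((a * f a - profile a x * f (profile a x)) / slope a x)) \<longlongrightarrow>
      lam a * f (profile a 0) * r (1 / 2) - c * lam a * 0) (at_right 0)"
    by (intro tendsto_intros amplitude_defect_limit a
        tendsto_at_right_of_continuous_on[OF f_profile_continuous[OF a]]) simp
  then have "lam a * f (profile a 0) * r (1 / 2) - c * lam a * 0 \<le> g 0"
    using tendsto_le[OF trivial_limit_at_right_real g0 _ lower] by blast
  moreover have "0 < lam a * f a * r (1 / 2)" using fa r_half by simp
  ultimately show ?thesis by (simp add: profile_0[OF a])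
qed

lemma half_linearized_uminus:
  assumes "half_linearized a w z g"
  shows "half_linearized a (\<lambda>x. - w x) (\<lambda>x. - z x) (\<lambda>x. - g x)"
  unfolding half_linearized_def
proof (intro conjI allI impI; (elim conjE)?)
  show "continuous_on {0..1} (\<lambda>x. - w x)" "continuous_on {0..1} (\<lambda>x. - z x)"
    using assms by (auto simp: half_linearized_def intro: continuous_on_minus)
  show "((\<lambda>x. - g x) \<longlongrightarrow> - g 0) (at_right 0)"
    using assms by (auto simp: half_linearized_def intro: tendsto_minus)
  fix x :: real assume x: "0 < x" "x < 1"
  show "((\<lambda>x. - w x) has_real_derivative - z x) (at x)"
    using assms x by (auto simp: half_linearized_def intro: DERIV_minus)
  show "((\<lambda>x. - g x) has_real_derivative - (lam a * f' (profile a x) * - w x)) (at x)"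
    using assms x DERIV_minus[of g "- (lam a * f' (profile a x) * w x)" x UNIV]
    by (simp add: half_linearized_def)
  show "- g x = (p - 1) * slope a x powr (p - 2) * - z x"
    using assms x by (simp add: half_linearized_def)
qed (use assms in \<open>simp add: half_linearized_def\<close>)

text \<open>Reflection turns the flux \<open>g\<close> into \<open>-g\<close>, so the two halves demand opposite signs of \<open>g(0)\<close> unless
  \<open>w(0) = 0\<close>.\<close>

lemma linearized_center_zero:
  assumes a: "a \<in> amplitudes"
    and right: "half_linearized a w z g"
    and left: "half_linearized a (\<lambda>x. w (- x)) z' (\<lambda>x. - g (- x))"
  shows "w 0 = 0"
proof (cases "w 0" "0 :: real" rule: linorder_cases)
  case less
  have "0 < - g 0"
    using half_linearized_flux_pos[OF a half_linearized_uminus[OF right]] less by simp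
  moreover have "0 < g 0"
    using half_linearized_flux_pos[OF a half_linearized_uminus[OF left]] less by simp
  ultimately show ?thesis by simp
next
  case greater
  then show ?thesis
    using half_linearized_flux_pos[OF a right] half_linearized_flux_pos[OF a left] by simp
qed

lemma sol_nondegenerate:
  assumes a: "a \<in> amplitudes" and nd: "2 < p \<or> slope a 1 \<noteq> 0"
  shows "nondegenerate p f' (lam a) (sol a)"
  unfolding nondegenerate_def
proof (intro allI impI ballI)
  fix w x assume lin: "linearized_solution p f' (lam a) (sol a) w" and x: "x \<in> {-1..1::real}"
  obtain g where C1: "C1_closed w" and w_ends: "w (-1) = 0" "w 1 = 0"
    and gC1: "g C1_differentiable_on {-1<..<1}"
    and g: "\<And>x. x \<in> {-1<..<1} \<Longrightarrow> D1 (sol a) x \<noteq> 0 \<Longrightarrow> g x = dphi p (D1 (sol a) x) * D1 w x"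
    and geq: "\<And>x. x \<in> {-1<..<1} \<Longrightarrow> deriv g x + lam a * f' (sol a x) * w x = 0"
    using lin unfolding linearized_solution_def by blast
  have gder: "(g has_real_derivative - (lam a * f' (profile a x) * w x)) (at x)" if x: "x \<in> {-1<..<1}" for x
  proof -
    obtain D where "(g has_real_derivative D) (at x)"
      using gC1 x unfolding C1_differentiable_on_def has_real_derivative_iff_has_vector_derivative by blast
    moreover from this have "D = - (lam a * f' (profile a x) * w x)"
      using geq[OF x] DERIV_imp_deriv x by (fastforce simp: sol_def)
    ultimately show ?thesis by simp
  qed
  have gx: "g x = (p - 1) * slope a x powr (p - 2) * D1 w x" if x: "x \<in> {-1<..<1}" "x \<noteq> 0" for x
    using g[OF x(1)] D1_sol(2)[OF a, of x] slope_pos[OF a x] x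
    by (simp add: dphi_def abs_mult sgn_zero_iff)
  have g_cont: "isCont g 0" using gder[of 0] DERIV_isCont by fastforce
  have prof_even: "profile a (- x) = profile a x" "slope a (- x) = slope a x" for x
    by (simp_all add: profile_def slope_def)
  have wcont: "continuous_on {-1..1} w" "continuous_on {-1..1} (D1 w)"
    using C1 C1_closed_continuous C1_closed_def by auto
  have right: "half_linearized a w (D1 w) g"
    unfolding half_linearized_def
    using gder gx C1_closed_DERIV[OF C1] w_ends g_cont
    by (auto intro: continuous_on_subset[OF wcont(1)] continuous_on_subset[OF wcont(2)]
        simp: isCont_def filterlim_at_split)
  have left: "half_linearized a (\<lambda>x. w (- x)) (\<lambda>x. - D1 w (- x)) (\<lambda>x. - g (- x))"
    unfolding half_linearized_def
  proof (intro conjI allI impI; (elim conjE)?)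
    show "continuous_on {0..1} (\<lambda>x. w (- x))" "continuous_on {0..1} (\<lambda>x. - D1 w (- x))"
      by (intro continuous_intros continuous_on_compose2[OF wcont(1)] continuous_on_compose2[OF wcont(2)]; auto)+
    have "isCont (\<lambda>x. - g (- x)) 0"
      using g_cont by (intro continuous_intros isCont_o2[of 0 uminus g]) auto
    then show "((\<lambda>x. - g (- x)) \<longlongrightarrow> - g (- 0)) (at_right 0)"
      by (simp add: isCont_def filterlim_at_split)
    fix x :: real assume x: "0 < x" "x < 1"
    show "((\<lambda>x. w (- x)) has_real_derivative - D1 w (- x)) (at x)"
      using C1_closed_DERIV[OF C1, of "- x"] x by (simp add: DERIV_mirror)
    have "((\<lambda>x. g (- x)) has_real_derivative - (- (lam a * f' (profile a (- x)) * w (- x)))) (at x)"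
      using gder[of "- x"] x by (simp add: DERIV_mirror)
    from DERIV_minus[OF this]
    show "((\<lambda>x. - g (- x)) has_real_derivative - (lam a * f' (profile a x) * w (- x))) (at x)"
      by (simp add: prof_even)
    show "- g (- x) = (p - 1) * slope a x powr (p - 2) * - D1 w (- x)"
      using gx[of "- x"] x by (simp add: prof_even)
  qed (use w_ends in simp)
  have "w 0 = 0" by (rule linearized_center_zero[OF a right left])
  then show "w x = 0"
    using half_linearized_zero[OF a right _ nd, of x] half_linearized_zero[OF a left _ nd, of "- x"] x
    by (cases "0 \<le> x") auto
qed

end

section \<open>The solution curve\<close>

context p_laplace_nonlinearity
begin

definition amp :: "real \<Rightarrow> real" where
  "amp l = inv_into amplitudes lam l"

definition U :: "real \<Rightarrow> real \<Rightarrow> real" where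
  "U l = sol (amp l)"

lemma lam_strict_antimono:
  assumes "a \<in> amplitudes" "a < b"
  shows "lam b < lam a"
proof -
  have "time_map b powr p < time_map a powr p"
    using time_map_strict_antimono[OF assms] time_map_pos[of b] amplitudes_upward[OF assms(1), of b] assms(2) p
    by (intro powr_less_mono2) auto
  then show ?thesis using p by (simp add: lam_def divide_strict_right_mono)
qed

lemma lam_less_iff:
  assumes "a \<in> amplitudes" "b \<in> amplitudes"
  shows "lam b < lam a \<longleftrightarrow> a < b"
  using lam_strict_antimono[of a b] lam_strict_antimono[of b a] assms
  by (cases a b rule: linorder_cases) auto

lemma lam_inj: "inj_on lam amplitudes"
  by (metis inj_onI lam_less_iff linorder_neqE less_irrefl)

lemma lam_continuous: "continuous_on amplitudes lam"
  unfolding lam_def using time_map_pos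
  by (intro continuous_intros time_map_continuous) (auto simp: less_le)

lemma amp_lam: "a \<in> amplitudes \<Longrightarrow> amp (lam a) = a"
  by (simp add: amp_def lam_inj)

lemma lam_amp:
  assumes "l \<in> lam ` amplitudes"
  shows "amp l \<in> amplitudes" "lam (amp l) = l"
  using assms by (auto simp: amp_def inv_into_into f_inv_into_f)

lemma amp_continuous: "continuous_on (lam ` amplitudes) amp"
proof -
  have "path_connected amplitudes"
    by (simp add: amplitudes_eq convex_imp_path_connected)
  then obtain g where g: "homeomorphism amplitudes (lam ` amplitudes) lam g"
    using homeomorphism_into_1d[OF _ lam_continuous refl lam_inj] by blast
  then have "continuous_on (lam ` amplitudes) g"
    by (simp add: homeomorphism_def)
  moreover have "g l = amp l" if "l \<in> lam ` amplitudes" for l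
    using that g by (auto simp: homeomorphism_def amp_lam)
  ultimately show ?thesis
    using continuous_on_eq by blast
qed

lemma lam_small:
  assumes "0 < e"
  shows "\<exists>a\<in>amplitudes. lam a < e"
proof -
  obtain a where a: "a \<in> amplitudes" "time_map a < (p / (p - 1) * e) powr (1 / p)"
    using time_map_small[of "(p / (p - 1) * e) powr (1 / p)"] assms p by auto
  have "time_map a powr p < ((p / (p - 1) * e) powr (1 / p)) powr p"
    using a time_map_pos[OF a(1)] p by (intro powr_less_mono2) auto
  also have "\<dots> = p / (p - 1) * e"
    using p assms by (simp add: powr_powr)
  finally have "lam a < e" using p by (simp add: lam_def field_simps)
  then show ?thesis using a(1) by blast
qed

lemma lam_large:
  assumes f0: "f 0 = 0"
  shows "\<exists>a\<in>amplitudes. M < lam a"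
proof -
  obtain a where a: "a \<in> amplitudes" "(p / (p - 1) * (\<bar>M\<bar> + 1)) powr (1 / p) < time_map a"
    using time_map_large[OF f0] by blast
  have "p / (p - 1) * (\<bar>M\<bar> + 1) = ((p / (p - 1) * (\<bar>M\<bar> + 1)) powr (1 / p)) powr p"
    using p by (simp add: powr_powr)
  also have "\<dots> < time_map a powr p"
    using a p by (intro powr_less_mono2) auto
  finally have "\<bar>M\<bar> + 1 < lam a" using p by (simp add: lam_def field_simps)
  then show ?thesis using a(1) by (intro bexI[of _ a]) auto
qed

lemma lam_range_downward:
  assumes "a \<in> amplitudes" "0 < l" "l \<le> lam a"
  shows "l \<in> lam ` amplitudes"
proof -
  obtain b where b: "b \<in> amplitudes" "lam b < l"
    using lam_small assms(2) by blast
  then have "a < b" using assms lam_less_iff[of a b] by auto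
  have sub: "{a..b} \<subseteq> amplitudes" using amplitudes_upward[OF assms(1)] by auto
  have "\<exists>x\<ge>a. x \<le> b \<and> lam x = l"
    using b assms(3) \<open>a < b\<close> continuous_on_subset[OF lam_continuous sub]
    by (intro IVT2') auto
  then show ?thesis using sub by auto
qed

lemma lam_range:
  "lam ` amplitudes = {l. 0 < l \<and> ereal l \<le> (if f 0 < 0 then ereal (lam \<theta>) else \<infinity>)}"
proof (cases "f 0 < 0")
  case True
  have \<theta>: "\<theta> \<in> amplitudes" using True by (simp add: amplitudes_eq)
  have "lam a \<le> lam \<theta>" if "a \<in> amplitudes" for a
    using lam_less_iff[OF that \<theta>] that True by (simp add: amplitudes_eq linorder_not_less[symmetric])
  then show ?thesis
    using lam_range_downward[OF \<theta>] lam_pos True by auto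
next
  case False
  then have f0: "f 0 = 0" using f_0_nonpos by simp
  have "l \<in> lam ` amplitudes" if "0 < l" for l
    using lam_large[OF f0, of l] lam_range_downward[OF _ that] by force
  then show ?thesis
    using lam_pos False by auto
qed

lemma positive_solution_iff:
  assumes "0 < l"
  shows "positive_solution p f l u \<longleftrightarrow> l \<in> lam ` amplitudes \<and> u = U l"
proof
  assume "positive_solution p f l u"
  then obtain a where "a \<in> amplitudes" "l = lam a" "u = sol a"
    using positive_solution_is_sol[OF assms] by blast
  then show "l \<in> lam ` amplitudes \<and> u = U l"
    by (simp add: U_def amp_lam)
next
  assume "l \<in> lam ` amplitudes \<and> u = U l"
  then show "positive_solution p f l u"
    using sol_positive_solution[of "amp l"] lam_amp[of l] by (simp add: U_def)
qed

text \<open>The derivative of \<open>U l\<close> is \<open>-sgn x slope\<close>, and multiplication by \<open>sgn x\<close> does not increase uniform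
  distances; so it suffices that \<open>profile\<close> and \<open>slope\<close> are jointly continuous in height and position.\<close>

lemma U_continuous: "continuous_in_C1 (lam ` amplitudes) U"
  unfolding continuous_in_C1_def
proof (intro ballI conjI)
  fix s assume s: "s \<in> lam ` amplitudes"
  let ?I = "lam ` amplitudes"
  have amp_fst: "continuous_on (?I \<times> {-1..1::real}) (\<lambda>z. amp (fst z))"
    by (rule continuous_on_compose2[OF amp_continuous]) (auto intro!: continuous_intros)
  have "continuous_on (?I \<times> {-1..1}) (\<lambda>z. profile (amp (fst z)) (snd z))"
    by (rule continuous_on_two_arguments[OF profile_continuous_joint amp_fst])
       (auto intro!: continuous_intros lam_amp)
  then have "uniform_limit {-1..1} (\<lambda>l. profile (amp l)) (profile (amp s)) (at s within ?I)"
    using s by (intro uniform_limit_of_joint_continuity) (auto simp: case_prod_beta')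
  then show "uniform_limit {-1..1} U (U s) (at s within ?I)"
    by (auto simp: uniform_limit_iff U_def sol_def)
  have "continuous_on (?I \<times> {-1..1}) (\<lambda>z. slope (amp (fst z)) (snd z))"
    by (rule continuous_on_two_arguments[OF slope_continuous_joint amp_fst])
       (auto intro!: continuous_intros lam_amp)
  then have lim: "uniform_limit {-1..1} (\<lambda>l. slope (amp l)) (slope (amp s)) (at s within ?I)"
    using s by (intro uniform_limit_of_joint_continuity) (auto simp: case_prod_beta')
  have in_I: "\<forall>\<^sub>F l in at s within ?I. l \<in> ?I"
    by (auto simp: eventually_at_filter)
  show "uniform_limit {-1..1} (\<lambda>l. D1 (U l)) (D1 (U s)) (at s within ?I)"
    unfolding uniform_limit_iff
  proof (intro allI impI)
    fix e :: real assume "e > 0"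
    then have "\<forall>\<^sub>F l in at s within ?I. \<forall>x\<in>{-1..1}. dist (slope (amp l) x) (slope (amp s) x) < e"
      using lim by (simp add: uniform_limit_iff)
    then show "\<forall>\<^sub>F l in at s within ?I. \<forall>x\<in>{-1..1}. dist (D1 (U l) x) (D1 (U s) x) < e"
      using in_I
    proof eventually_elim
      case (elim l)
      show ?case
      proof
        fix x :: real assume x: "x \<in> {-1..1}"
        have "dist (D1 (U l) x) (D1 (U s) x) \<le> dist (slope (amp l) x) (slope (amp s) x)"
          using D1_sol(2)[OF lam_amp(1)[OF elim(2)] x] D1_sol(2)[OF lam_amp(1)[OF s] x]
          by (auto simp: U_def dist_real_def sgn_if)
        then show "dist (D1 (U l) x) (D1 (U s) x) < e" using elim(1) x by force
      qed
    qed
  qed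
qed

lemma U_nondegenerate:
  assumes "l \<in> lam ` amplitudes" "2 < p \<or> D1 (U l) 1 \<noteq> 0"
  shows "nondegenerate p f' l (U l)"
  using sol_nondegenerate[OF lam_amp(1)[OF assms(1)]] lam_amp[OF assms(1)] assms(2)
  by (auto simp: U_def D1_sol(2))

lemma D1_U_1_nonzero:
  assumes "l \<in> lam ` amplitudes" "\<theta> < amp l"
  shows "D1 (U l) 1 \<noteq> 0"
proof -
  have a: "amp l \<in> amplitudes" by (rule lam_amp(1)[OF assms(1)])
  have "0 < F (amp l)" using F_increasing[of \<theta> "amp l"] theta assms(2) by simp
  then show ?thesis
    using D1_sol(2)[OF a, of 1] time_map_pos[OF a] by (simp add: U_def slope_def profile_1[OF a])
qed

lemma D1_U_theta:
  assumes "f 0 < 0"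
  shows "D1 (U (lam \<theta>)) (-1) = 0" "D1 (U (lam \<theta>)) 1 = 0"
proof -
  have \<theta>: "\<theta> \<in> amplitudes" using assms by (simp add: amplitudes_eq)
  show "D1 (U (lam \<theta>)) (-1) = 0" "D1 (U (lam \<theta>)) 1 = 0"
    by (simp_all add: U_def amp_lam[OF \<theta>] D1_sol(2)[OF \<theta>] slope_def profile_1[OF \<theta>] theta)
qed

lemma amp_less:
  assumes "l \<in> lam ` amplitudes" "a \<in> amplitudes"
  shows "lam a < l \<longleftrightarrow> amp l < a" "l < lam a \<longleftrightarrow> a < amp l"
  using lam_less_iff[OF lam_amp(1)[OF assms(1)] assms(2)] lam_less_iff[OF assms(2) lam_amp(1)[OF assms(1)]]
    lam_amp(2)[OF assms(1)] by auto

lemma U_0: "l \<in> lam ` amplitudes \<Longrightarrow> U l 0 = amp l"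
  using lam_amp(1)[of l] by (simp add: U_def sol_def profile_0)

lemma in_range_near_0: "a \<in> amplitudes \<Longrightarrow> \<forall>\<^sub>F l in at_right 0. l \<in> lam ` amplitudes \<and> l < lam a"
  using eventually_at_right_real[OF lam_pos]
  by (rule eventually_mono) (auto intro: lam_range_downward)

lemma U_0_at_top: "filterlim (\<lambda>l. U l 0) at_top (at_right 0)"
  unfolding filterlim_at_top
proof
  fix Z :: real
  have a: "max Z (\<theta> + 1) \<in> amplitudes" by (auto simp: amplitudes_eq)
  show "\<forall>\<^sub>F l in at_right 0. Z \<le> U l 0"
    using in_range_near_0[OF a] by eventually_elim (auto simp: U_0 amp_less(2)[OF _ a])
qed

lemma U_tendsto_0:
  assumes f0: "f 0 = 0" and x: "x \<in> {-1..1} - {0}"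
  shows "((\<lambda>l. U l x) \<longlongrightarrow> 0) at_top"
proof (rule order_tendstoI)
  have large: "\<forall>\<^sub>F l in at_top. l \<in> lam ` amplitudes \<and> M < l" for M
    using eventually_gt_at_top[of "max M 0"]
    by eventually_elim (use f0 in \<open>simp add: lam_range\<close>)
  have \<theta>0: "0 < \<theta>" using theta \<gamma> by simp
  show "\<forall>\<^sub>F l in at_top. e < U l x" if "e < 0" for e
    using large[of 0]
    by eventually_elim (use that x profile_range(1)[OF lam_amp(1)] in \<open>force simp: U_def sol_def\<close>)
  show "\<forall>\<^sub>F l in at_top. U l x < e" if "0 < e" for e
  proof -
    define a2 where "a2 = \<theta> + 1"
    have a2: "a2 \<in> amplitudes" by (auto simp: a2_def amplitudes_eq)
    define d where "d = min (1 / 2) (e / a2)"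
    have d: "0 < d" "d < 1" "d \<le> e / a2"
      using that \<theta>0 by (auto simp: d_def a2_def)
    obtain a1 where a1: "a1 \<in> amplitudes" "\<And>a. a \<in> amplitudes \<Longrightarrow> a < a1 \<Longrightarrow> rel_height a \<bar>x\<bar> < d"
      using rel_height_small_near_theta[OF f0, of "\<bar>x\<bar>" d] x d(1,2) by (auto simp: abs_le_iff)
    show ?thesis
      using large[of "max (lam a1) (lam a2)"]
    proof eventually_elim
      case (elim l)
      then have a: "amp l \<in> amplitudes" "amp l < a1" "amp l < a2"
        using lam_amp(1)[of l] amp_less(1)[of l a1] amp_less(1)[of l a2] a1(1) a2 by auto
      have "amp l * rel_height (amp l) \<bar>x\<bar> < a2 * d"
        using a1(2)[OF a(1,2)] a(3) amplitudesD(2)[OF a(1)] rel_height_works[OF a(1), of "\<bar>x\<bar>"] x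
        by (intro mult_strict_mono') auto
      also have "a2 * d \<le> e"
        using d(3) \<theta>0 by (simp add: a2_def pos_le_divide_eq mult.commute)
      finally show ?case using x by (simp add: U_def sol_def profile_def)
    qed
  qed
qed

lemma U_solution_curve: "solution_curve p f ((\<lambda>l. (l, U l)) ` (lam ` amplitudes))"
  unfolding solution_curve_def
proof (intro exI[of _ "lam ` amplitudes"] exI[of _ "\<lambda>l. l"] exI[of _ U] conjI ballI)
  show "is_interval (lam ` amplitudes)"
    unfolding lam_range is_interval_1 by (auto intro: order_trans)
  show "lam ` amplitudes \<noteq> {}"
    by (auto simp: amplitudes_eq)
  show "continuous_in_C1 (lam ` amplitudes) U" by (rule U_continuous)
  fix s assume s: "s \<in> lam ` amplitudes"
  then show "0 < s" using lam_pos by auto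
  then show "positive_solution p f s (U s)" using positive_solution_iff s by blast
qed auto

end

theorem theorem3p1:
  fixes p \<gamma> :: real and f f' :: "real \<Rightarrow> real"
  assumes p: "p > 1"
    and f_deriv: "\<And>u. u \<ge> 0 \<Longrightarrow> (f has_real_derivative f' u) (at u within {0..})"
    and f'_cont: "continuous_on {0..} f'"
    and \<gamma>: "\<gamma> > 0"
    and f_neg: "\<And>u. 0 < u \<Longrightarrow> u < \<gamma> \<Longrightarrow> f u < 0"
    and f_pos: "\<And>u. \<gamma> < u \<Longrightarrow> f u > 0"
    and f_superlin: "\<And>u. \<gamma> < u \<Longrightarrow> f' u - (p - 1) * (f u / u) > 0"
    and f_growth: "\<exists>q>p - 1. \<exists>L>0. ((\<lambda>u. f u / u powr q) \<longlongrightarrow> L) at_top"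
    and f_zero: "f 0 = 0 \<Longrightarrow> \<exists>c\<^sub>0>0. \<forall>\<^sub>F s in at_right 0. - f s < c\<^sub>0 * s powr (p - 1)"
  shows
    "(\<forall>l>0. \<forall>u v. positive_solution p f l u \<longrightarrow> positive_solution p f l v \<longrightarrow> u = v) \<and>
     (\<forall>\<^sub>F l in at_right 0. \<exists>!u. positive_solution p f l u) \<and>
     (\<forall>l>0. \<forall>u. positive_solution p f l u \<longrightarrow> 2 < p \<or> D1 u 1 \<noteq> 0 \<longrightarrow> nondegenerate p f' l u) \<and>
     (\<exists>!C. solution_curve p f C \<and> (\<forall>l>0. \<forall>u. positive_solution p f l u \<longrightarrow> (l, u) \<in> C)) \<and>
     (\<exists>C lam0 U.
        solution_curve p f C \<and> (\<forall>l>0. \<forall>u. positive_solution p f l u \<longrightarrow> (l, u) \<in> C) \<and>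
        (0::ereal) < lam0 \<and> fst ` C = {l. 0 < l \<and> ereal l \<le> lam0} \<and>
        (\<forall>l\<in>fst ` C. positive_solution p f l (U l)) \<and>
        (f 0 < 0 \<longrightarrow>
           lam0 < \<infinity> \<and> no_turns C \<and>
           filterlim (\<lambda>l. U l 0) at_top (at_right 0) \<and>
           D1 (U (real_of_ereal lam0)) (-1) = 0 \<and> D1 (U (real_of_ereal lam0)) 1 = 0 \<and>
           (\<forall>l. ereal l > lam0 \<longrightarrow> \<not> (\<exists>u. positive_solution p f l u)) \<and>
           (\<forall>l. 0 < l \<and> ereal l \<le> lam0 \<longrightarrow>
              (\<exists>!u. positive_solution p f l u) \<and>
              (2 < p \<or> ereal l < lam0 \<longrightarrow> nondegenerate p f' l (U l)))) \<and>
        (f 0 = 0 \<longrightarrow>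
           lam0 = \<infinity> \<and> no_turns C \<and>
           filterlim (\<lambda>l. U l 0) at_top (at_right 0) \<and>
           (\<forall>x\<in>{-1..1} - {0}. ((\<lambda>l. U l x) \<longlongrightarrow> 0) at_top) \<and>
           (\<forall>l>0. (\<exists>!u. positive_solution p f l u) \<and> nondegenerate p f' l (U l))))"
proof -
  interpret p_laplace_nonlinearity p \<gamma> f f'
    by unfold_locales (fact assms)+
  define R where "R = lam ` amplitudes"
  define C where "C = (\<lambda>l. (l, U l)) ` R"
  define lam0 :: ereal where "lam0 = (if f 0 < 0 then ereal (lam \<theta>) else \<infinity>)"
  have R: "R = {l. 0 < l \<and> ereal l \<le> lam0}"
    unfolding R_def lam0_def by (rule lam_range)
  have R_pos: "0 < l" if "l \<in> R" for l using that R by simp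
  have sol_iff: "positive_solution p f l u \<longleftrightarrow> l \<in> R \<and> u = U l" if "0 < l" for l u
    using positive_solution_iff[OF that] by (simp add: R_def)
  have curve: "solution_curve p f C"
    unfolding C_def R_def by (rule U_solution_curve)
  have all: "\<forall>l>0. \<forall>u. positive_solution p f l u \<longrightarrow> (l, u) \<in> C"
    by (auto simp: sol_iff C_def)
  have fst_C: "fst ` C = R" by (force simp: C_def)
  have no_turns: "no_turns C"
    unfolding no_turns_def fst_C using U_continuous by (auto simp: C_def R_def)
  have ex1: "\<exists>!u. positive_solution p f l u" if "l \<in> R" for l
    unfolding sol_iff[OF R_pos[OF that]] using that by blast
  have curve_unique: "D = C"
    if "solution_curve p f D" "\<forall>l>0. \<forall>u. positive_solution p f l u \<longrightarrow> (l, u) \<in> D" for D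
  proof
    show "D \<subseteq> C"
      using that(1) by (auto simp: solution_curve_def C_def sol_iff)
    show "C \<subseteq> D"
      using that(2) R_pos sol_iff by (auto simp: C_def)
  qed
  have theta1: "\<theta> + 1 \<in> amplitudes" by (simp add: amplitudes_eq)
  have nondeg: "nondegenerate p f' l (U l)" if "l \<in> R" "2 < p \<or> D1 (U l) 1 \<noteq> 0" for l
    using U_nondegenerate that by (simp add: R_def)
  have nondeg_all: "nondegenerate p f' l u"
    if "0 < l" "positive_solution p f l u" "2 < p \<or> D1 u 1 \<noteq> 0" for l u
    using that nondeg[of l] unfolding sol_iff[OF that(1)] by simp
  have pos_lam0: "0 < lam0"
    using lam_pos[of \<theta>] by (auto simp: lam0_def amplitudes_eq)
  have case_a: "lam0 < \<infinity> \<and> no_turns C \<and> filterlim (\<lambda>l. U l 0) at_top (at_right 0) \<and>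
      D1 (U (real_of_ereal lam0)) (-1) = 0 \<and> D1 (U (real_of_ereal lam0)) 1 = 0 \<and>
      (\<forall>l. ereal l > lam0 \<longrightarrow> \<not> (\<exists>u. positive_solution p f l u)) \<and>
      (\<forall>l. 0 < l \<and> ereal l \<le> lam0 \<longrightarrow> (\<exists>!u. positive_solution p f l u) \<and>
        (2 < p \<or> ereal l < lam0 \<longrightarrow> nondegenerate p f' l (U l)))" if f0: "f 0 < 0"
  proof (intro conjI allI impI)
    have lam0: "lam0 = ereal (lam \<theta>)" using f0 by (simp add: lam0_def)
    have \<theta>: "\<theta> \<in> amplitudes" using f0 by (simp add: amplitudes_eq)
    show "lam0 < \<infinity>" by (simp add: lam0)
    show "D1 (U (real_of_ereal lam0)) (-1) = 0" "D1 (U (real_of_ereal lam0)) 1 = 0"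
      using D1_U_theta[OF f0] by (simp_all add: lam0)
    show "\<not> (\<exists>u. positive_solution p f l u)" if "ereal l > lam0" for l
    proof -
      have "0 < l" "l \<notin> R" using that lam_pos[OF \<theta>] by (auto simp: lam0 R)
      then show ?thesis by (simp add: sol_iff)
    qed
    fix l assume "0 < l \<and> ereal l \<le> lam0"
    then have l: "l \<in> R" by (simp add: R)
    then show "\<exists>!u. positive_solution p f l u" by (rule ex1)
    assume "2 < p \<or> ereal l < lam0"
    then show "nondegenerate p f' l (U l)"
      using nondeg[OF l] D1_U_1_nonzero[of l] amp_less(2)[of l \<theta>] l \<theta>
      by (auto simp: lam0 R_def)
  qed (rule no_turns U_0_at_top)+
  have case_b: "lam0 = \<infinity> \<and> no_turns C \<and> filterlim (\<lambda>l. U l 0) at_top (at_right 0) \<and>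
      (\<forall>x\<in>{-1..1} - {0}. ((\<lambda>l. U l x) \<longlongrightarrow> 0) at_top) \<and>
      (\<forall>l>0. (\<exists>!u. positive_solution p f l u) \<and> nondegenerate p f' l (U l))" if f0: "f 0 = 0"
  proof (intro conjI ballI allI impI)
    show lam0: "lam0 = \<infinity>" using f0 by (simp add: lam0_def)
    show "((\<lambda>l. U l x) \<longlongrightarrow> 0) at_top" if "x \<in> {-1..1} - {0}" for x
      by (rule U_tendsto_0[OF f0 that])
    fix l :: real assume "0 < l"
    then have l: "l \<in> R" by (simp add: R lam0)
    then show "\<exists>!u. positive_solution p f l u" by (rule ex1)
    have "\<theta> < amp l" using lam_amp(1)[of l] l f0 by (simp add: R_def amplitudes_eq)
    then show "nondegenerate p f' l (U l)"
      using nondeg[OF l] D1_U_1_nonzero[of l] l by (simp add: R_def)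
  qed (rule no_turns U_0_at_top)+
  show ?thesis
  proof (intro conjI)
    show "\<forall>l>0. \<forall>u v. positive_solution p f l u \<longrightarrow> positive_solution p f l v \<longrightarrow> u = v"
      by (simp add: sol_iff)
    show "\<forall>\<^sub>F l in at_right 0. \<exists>!u. positive_solution p f l u"
      using in_range_near_0[OF theta1] by eventually_elim (use ex1 in \<open>auto simp: R_def\<close>)
    show "\<forall>l>0. \<forall>u. positive_solution p f l u \<longrightarrow> 2 < p \<or> D1 u 1 \<noteq> 0 \<longrightarrow> nondegenerate p f' l u"
      using nondeg_all by blast
    show "\<exists>!C. solution_curve p f C \<and> (\<forall>l>0. \<forall>u. positive_solution p f l u \<longrightarrow> (l, u) \<in> C)"
      using curve all curve_unique by blast
    show "\<exists>C lam0 U.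
        solution_curve p f C \<and> (\<forall>l>0. \<forall>u. positive_solution p f l u \<longrightarrow> (l, u) \<in> C) \<and>
        (0::ereal) < lam0 \<and> fst ` C = {l. 0 < l \<and> ereal l \<le> lam0} \<and>
        (\<forall>l\<in>fst ` C. positive_solution p f l (U l)) \<and>
        (f 0 < 0 \<longrightarrow>
           lam0 < \<infinity> \<and> no_turns C \<and>
           filterlim (\<lambda>l. U l 0) at_top (at_right 0) \<and>
           D1 (U (real_of_ereal lam0)) (-1) = 0 \<and> D1 (U (real_of_ereal lam0)) 1 = 0 \<and>
           (\<forall>l. ereal l > lam0 \<longrightarrow> \<not> (\<exists>u. positive_solution p f l u)) \<and>
           (\<forall>l. 0 < l \<and> ereal l \<le> lam0 \<longrightarrow>
              (\<exists>!u. positive_solution p f l u) \<and>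
              (2 < p \<or> ereal l < lam0 \<longrightarrow> nondegenerate p f' l (U l)))) \<and>
        (f 0 = 0 \<longrightarrow>
           lam0 = \<infinity> \<and> no_turns C \<and>
           filterlim (\<lambda>l. U l 0) at_top (at_right 0) \<and>
           (\<forall>x\<in>{-1..1} - {0}. ((\<lambda>l. U l x) \<longlongrightarrow> 0) at_top) \<and>
           (\<forall>l>0. (\<exists>!u. positive_solution p f l u) \<and> nondegenerate p f' l (U l)))"
    proof (intro exI[of _ C] exI[of _ lam0] exI[of _ U] conjI impI)
      show "fst ` C = {l. 0 < l \<and> ereal l \<le> lam0}" using fst_C R by simp
      show "\<forall>l\<in>fst ` C. positive_solution p f l (U l)"
        by (simp add: fst_C sol_iff R_pos)
    qed (use curve all pos_lam0 case_a case_b in blast)+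
  qed
qed

end
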